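(* Let $\mathcal{X},\mathcal{Z}$ be Euclidean spaces (finite-dimensional real Hilbert spaces), and let $\phi,h,\mathfrak{S},g$ satisfy: (i) $\phi:\mathcal{X}\to\mathbb{R}\cup\{+\infty\}$ is proper, lower semicontinuous, convex (and prox-friendly); (ii) $h:\mathcal{X}\to\mathbb{R}$ is differentiable and $\nabla h:\mathcal{X}\to\mathcal{X}$ is Lipschitz continuous over $\mathrm{dom}(\phi)=\{\bm{x}\in\mathcal{X}\mid\phi(\bm{x})<+\infty\}$; (iii) $\mathfrak{S}:\mathcal{X}\to\mathcal{Z}$ is a continuously differentiable mapping; (iv) $g:\mathcal{Z}\to\mathbb{R}$ is Lipschitz continuous and $\eta$-weakly convex with $\eta>0$, i.e., $g+\frac{\eta}{2}\|\cdot\|^2$ is convex (and $g$ is prox-friendly); (v) with $f:=h+g\circ\mathfrak{S}$, $\inf\{(f+\phi)(\bm{x})\mid\bm{x}\in\mathrm{dom}(\phi)\}>-\infty$. Let $\bm{x}_1\in\mathrm{dom}(\phi)$, $c\in(0,1)$, and $(\mu_n)_{n=1}^\infty\subset(0,(2\eta)^{-1}]$ be arbitrary such that $\lim_{n\to\infty}\mu_n=0$, $\sum_{n=1}^\infty\mu_n=+\infty$, and there is $M\ge1$ with $M^{-1}\le\mu_{n+1}/\mu_n\le1$ for all $n\in\mathbb{N}$. Put $f_n:=h+{}^{\mu_n}g\circ\mathfrak{S}$, where ${}^{\mu_n}g$ is the Moreau envelope of $g$ of index $\mu_n$. Let $(\bm{x}_n)_{n=1}^\infty\subset\mathcal{X}$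 be generated by $$\bm{x}_{n+1}:=\mathrm{prox}_{\gamma_n\phi}\big(\bm{x}_n-\gamma_n\nabla f_n(\bm{x}_n)\big)\qquad(n\in\mathbb{N})$$ with stepsizes $\gamma_n>0$, and assume: (A) there exist $\varpi_1,\varpi_2>0$ such that, for every $n\in\mathbb{N}$, $\nabla f_n$ is Lipschitz continuous with Lipschitz constant $L_{\nabla f_n}:=\varpi_1+\varpi_2\mu_n^{-1}$; (B) for some $\beta>0$ and for the constant $c\in(0,1)$ chosen together with $\bm{x}_1$ and $(\mu_n)_{n=1}^\infty$, every $\gamma_n$ $(n\in\mathbb{N})$ satisfies the Armijo-type condition $$(f_n+\phi)\big(\mathrm{prox}_{\gamma_n\phi}(\bm{x}_n-\gamma_n\nabla f_n(\bm{x}_n))\big)\le(f_n+\phi)(\bm{x}_n)-c\,\gamma_n\big(\mathcal{M}_{\gamma_n}^{f_n,\phi}(\bm{x}_n)\big)^2$$ and $\gamma_n\ge\beta L_{\nabla f_n}^{-1}$; moreover $\bar\gamma:=\sup_{n\in\mathbb{N}}\gamma_n<+\infty$. Then the following hold, with the stationarity measure $\mathcal{M}_\gamma^{f_n,\phi}$ defined in the context: (a) $\displaystyle\liminf_{n\to\infty}\mathcal{M}_{\bar\gamma}^{f_n,\phi}(\bm{x}_n)=0.$ (b) One can choose a subsequence $(\bm{x}_{m(l)})_{l=1}^\infty$ of $(\bm{x}_n)_{n=1}^\infty$, with $m:\mathbb{N}\to\mathbb{N}$ monotonically (strictly) increasing, such that $\lim_{l\to\infty}\mathcal{M}_{\bar\gamma}^{f_{m(l)},\phi}(\bm{x}_{m(l)})=0$.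 Moreover, every cluster point $\bm{x}^\star\in\mathcal{X}$ of $(\bm{x}_{m(l)})_{l=1}^\infty$ is a stationary point of $f+\phi$.
   Context: Prox-friendly: the proximity operator has a closed-form expression (an informal computability requirement). Subdifferentials. For $J:\mathcal{X}\to\mathbb{R}\cup\{+\infty\}$ and $\bar{\bm{x}}\in\mathrm{dom}(J)$, the regular subdifferential is $$\widehat\partial J(\bar{\bm{x}}):=\Big\{\bm{v}\in\mathcal{X}\ \Big|\ \liminf_{\bm{x}\to\bar{\bm{x}},\,\bm{x}\ne\bar{\bm{x}}}\frac{J(\bm{x})-J(\bar{\bm{x}})-\langle\bm{v},\bm{x}-\bar{\bm{x}}\rangle}{\|\bm{x}-\bar{\bm{x}}\|}\ge0\Big\},$$ and the general subdifferential $\partial J(\bar{\bm{x}})$ is the set of all $\bm{v}\in\mathcal{X}$ for which there exist $\bm{x}_n\to\bar{\bm{x}}$ with $J(\bm{x}_n)\to J(\bar{\bm{x}})$ and $\bm{v}_n\in\widehat\partial J(\bm{x}_n)$ with $\bm{v}_n\to\bm{v}$. Both are $\emptyset$ if $\bar{\bm{x}}\notin\mathrm{dom}(J)$. For convex $J$ both coincide with the convex subdifferential. Stationary point: $\bm{x}^\star\in\mathcal{X}$ is a stationary point of $f+\phi$ if $\bm{0}\in\partial(f+\phi)(\bm{x}^\star)\ (=\partial f(\bm{x}^\star)+\partial\phi(\bm{x}^\star))$. Proximity operators and Moreau envelope. For $\gamma>0$, $\mathrm{prox}_{\gamma\phi}(\bar{\bm{x}}):=\operatorname{argmin}_{\bm{x}\in\mathcal{X}}\big(\phi(\bm{x})+\frac1{2\gamma}\|\bm{x}-\bar{\bm{x}}\|^2\big)$,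 which is single-valued. For $\mu\in(0,\eta^{-1})$, the Moreau envelope of $g$ of index $\mu$ is ${}^{\mu}g(\bar{\bm{z}}):=\min_{\bm{z}\in\mathcal{Z}}\big(g(\bm{z})+\frac1{2\mu}\|\bm{z}-\bar{\bm{z}}\|^2\big)$, which is continuously differentiable. The notation ${}^{\mu}g\circ\mathfrak{S}$ means $({}^{\mu}g)\circ\mathfrak{S}$. Stationarity measure. For $F:\mathcal{X}\to\mathbb{R}$ (used with $F=f_n$), $\gamma>0$ and $\bar{\bm{x}}\in\mathcal{X}$, $$\mathcal{M}_\gamma^{F,\phi}(\bar{\bm{x}}):=\inf\big\{\gamma^{-1}\|\bar{\bm{x}}-\mathrm{prox}_{\gamma\phi}(\bar{\bm{x}}-\gamma\bm{v})\|\ \big|\ \bm{v}\in\partial F(\bar{\bm{x}})\big\}.$$ $\mathbb{N}$ denotes the positive integers. *)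

theory Defs
  imports "HOL-Analysis.Analysis"
begin

text \<open>Extended-valued functions take values in \<open>ereal\<close>; the codomain
  \<open>\<real> \<union> {+\<infinity>}\<close> is expressed by excluding the value \<open>-\<infinity>\<close> in \<open>proper\<close>.\<close>

definition eff_dom :: "('a \<Rightarrow> ereal) \<Rightarrow> 'a set" where
  "eff_dom \<phi> = {x. \<phi> x < \<infinity>}"

definition proper :: "('a \<Rightarrow> ereal) \<Rightarrow> bool" where
  "proper \<phi> \<longleftrightarrow> (\<forall>x. \<phi> x \<noteq> -\<infinity>) \<and> eff_dom \<phi> \<noteq> {}"

definition lower_semicontinuous :: "('a::topological_space \<Rightarrow> ereal) \<Rightarrow> bool" where
  "lower_semicontinuous \<phi> \<longleftrightarrow> (\<forall>x. \<phi> x \<le> Liminf (at x) \<phi>)"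

text \<open>Jensen's inequality in \<open>ereal\<close>; only meaningful for functions that
  never take the value \<open>-\<infinity>\<close>.  The convention \<open>0 * \<infinity> = 0\<close> makes the cases
  \<open>u = 0\<close> and \<open>v = 0\<close> trivial.\<close>

definition ereal_convex :: "('a::real_vector \<Rightarrow> ereal) \<Rightarrow> bool" where
  "ereal_convex \<phi> \<longleftrightarrow>
     (\<forall>x y. \<forall>u\<ge>0. \<forall>v\<ge>0. u + v = 1 \<longrightarrow>
        \<phi> (u *\<^sub>R x + v *\<^sub>R y) \<le> ereal u * \<phi> x + ereal v * \<phi> y)"

definition weakly_convex :: "real \<Rightarrow> ('a::real_normed_vector \<Rightarrow> real) \<Rightarrow> bool" where
  "weakly_convex \<eta> g \<longleftrightarrow> convex_on UNIV (\<lambda>z. g z + \<eta> / 2 * (norm z)\<^sup>2)"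

definition grad :: "('a::real_inner \<Rightarrow> real) \<Rightarrow> 'a \<Rightarrow> 'a" where
  "grad F x = (THE v. GDERIV F x :> v)"

definition continuously_differentiable ::
  "('a::real_normed_vector \<Rightarrow> 'b::real_normed_vector) \<Rightarrow> bool" where
  "continuously_differentiable G \<longleftrightarrow>
     (\<exists>G' :: 'a \<Rightarrow> 'a \<Rightarrow>\<^sub>L 'b.
        (\<forall>x. (G has_derivative blinfun_apply (G' x)) (at x)) \<and> continuous_on UNIV G')"

definition regular_subdiff :: "('a::euclidean_space \<Rightarrow> ereal) \<Rightarrow> 'a \<Rightarrow> 'a set" where
  "regular_subdiff J xb =
     (if xb \<in> eff_dom J
      then {v. Liminf (at xb)
                 (\<lambda>x. (J x - J xb - ereal (v \<bullet> (x - xb))) / ereal (norm (x - xb))) \<ge> 0}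
      else {})"

definition general_subdiff :: "('a::euclidean_space \<Rightarrow> ereal) \<Rightarrow> 'a \<Rightarrow> 'a set" where
  "general_subdiff J xb =
     (if xb \<in> eff_dom J
      then {v. \<exists>xs vs. xs \<longlonglongrightarrow> xb \<and> (\<lambda>n. J (xs n)) \<longlonglongrightarrow> J xb \<and>
                  (\<forall>n. vs n \<in> regular_subdiff J (xs n)) \<and> vs \<longlonglongrightarrow> v}
      else {})"

definition stationary_point :: "('a::euclidean_space \<Rightarrow> ereal) \<Rightarrow> 'a \<Rightarrow> bool" where
  "stationary_point J x \<longleftrightarrow> 0 \<in> general_subdiff J x"

text \<open>For proper lower semicontinuous convex \<open>\<phi>\<close> and \<open>\<gamma> > 0\<close> the minimizer
  exists and is unique, so the choice made by \<open>ARG_MIN\<close> is immaterial.\<close>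

definition prox :: "real \<Rightarrow> ('a::euclidean_space \<Rightarrow> ereal) \<Rightarrow> 'a \<Rightarrow> 'a" where
  "prox \<gamma> \<phi> xb = (ARG_MIN (\<lambda>x. \<phi> x + ereal (1 / (2 * \<gamma>) * (norm (x - xb))\<^sup>2)) x. True)"

text \<open>For \<open>\<eta>\<close>-weakly convex \<open>g\<close> and \<open>0 < \<mu> < 1/\<eta>\<close> the infimum is finite and attained.\<close>

definition moreau_envelope :: "real \<Rightarrow> ('a::euclidean_space \<Rightarrow> real) \<Rightarrow> 'a \<Rightarrow> real" where
  "moreau_envelope \<mu> g zb = (INF z. g z + 1 / (2 * \<mu>) * (norm (z - zb))\<^sup>2)"

text \<open>The infimum is taken in \<open>ereal\<close>, so that it is \<open>\<infinity>\<close> when the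
  subdifferential is empty.\<close>

definition stationarity_measure ::
  "real \<Rightarrow> ('a::euclidean_space \<Rightarrow> real) \<Rightarrow> ('a \<Rightarrow> ereal) \<Rightarrow> 'a \<Rightarrow> ereal" where
  "stationarity_measure \<gamma> F \<phi> xb =
     (INF v \<in> general_subdiff (\<lambda>x. ereal (F x)) xb.
        ereal (inverse \<gamma> * norm (xb - prox \<gamma> \<phi> (xb - \<gamma> *\<^sub>R v))))"

definition cluster_point :: "(nat \<Rightarrow> 'a::topological_space) \<Rightarrow> 'a \<Rightarrow> bool" where
  "cluster_point s a \<longleftrightarrow> (\<exists>r::nat \<Rightarrow> nat. strict_mono r \<and> (s \<circ> r) \<longlonglongrightarrow> a)"

end

theory Submission
  imports Defs
begin

text \<open>The Moreau envelopes increase by at most a multiple of \<open>\<mu>\<^sub>n - \<mu>\<^sub>n\<^sub>+\<^sub>1\<close> from step \<open>n\<close>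
  to step \<open>n + 1\<close>, so \<open>(f\<^sub>n + \<phi>)(x\<^sub>n) + C \<mu>\<^sub>n\<close> is a Lyapunov function which the Armijo condition
  decreases by at least a multiple of \<open>\<mu>\<^sub>n\<close> times the squared stationarity measure at \<open>\<gamma>\<^sub>n\<close>; as the
  measure is nonincreasing in the stepsize, it may be replaced by the one at the supremum of
  the stepsizes.  Since \<open>\<Sum> \<mu>\<^sub>n = \<infinity>\<close> and the Lyapunov function is bounded below, the measure has
  limit inferior \<open>0\<close>.

  At a cluster point, the gradients of the envelopes are bounded and converge along a subsequence
  to some \<open>u\<close>.  The subgradient inequality of \<open>\<phi>\<close> and the weak subgradient inequality
  \<open>g w \<ge> g p + u \<bullet> (w - p) - \<eta>/2 |w - p|\<^sup>2\<close> pass to the limit and together show that \<open>0\<close> is already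
  a regular subgradient, so no calculus rule for the limiting subdifferential is needed.\<close>

subsection \<open>Proximity operators\<close>

text \<open>The lower limit in \<open>lower_semicontinuous\<close> ignores the point
  \<open>a\<close>; the strict inequality \<open>d < \<phi> a\<close> fills it in, so sequences that
  hit \<open>a\<close> are covered. The moving bound \<open>C\<close> lets the lemma also pass to
  the limit in subgradient inequalities.\<close>

lemma lower_semicontinuous_le_lim:
  fixes \<phi> :: "'a::metric_space \<Rightarrow> ereal"
  assumes lsc: "lower_semicontinuous \<phi>"
    and X: "X \<longlonglongrightarrow> a" and C: "C \<longlonglongrightarrow> c" and le: "\<And>n. \<phi> (X n) \<le> C n"
  shows "\<phi> a \<le> c"
proof (rule ccontr)
  assume "\<not> \<phi> a \<le> c"
  then have "c < \<phi> a" by simp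
  then obtain d where d: "c < d" "d < \<phi> a"
    using dense by blast
  have "d < Liminf (at a) \<phi>"
    using lsc d(2) unfolding lower_semicontinuous_def by (meson less_le_trans)
  then have "eventually (\<lambda>x. \<phi> x > d) (at a)"
    by (rule less_LiminfD)
  then have "eventually (\<lambda>x. \<phi> x > d) (nhds a)"
    using d(2) by (auto simp: eventually_at_filter elim: eventually_mono)
  then have "eventually (\<lambda>n. \<phi> (X n) > d) sequentially"
    using X by (rule eventually_compose_filterlim)
  moreover have "eventually (\<lambda>n. C n < d) sequentially"
    using C d(1) by (rule order_tendstoD)
  ultimately have "eventually (\<lambda>n. False) sequentially"
    by eventually_elim (use le in \<open>meson less_le_trans less_asym le_less_trans\<close>)
  then show False by simp
qed

lemma lower_semicontinuous_add_continuous: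
  fixes \<phi> :: "'a::metric_space \<Rightarrow> ereal" and q :: "'a \<Rightarrow> real"
  assumes lsc: "lower_semicontinuous \<phi>" and q: "continuous_on UNIV q"
  shows "lower_semicontinuous (\<lambda>x. \<phi> x + ereal (q x))"
  unfolding lower_semicontinuous_def
proof (intro allI, subst le_Liminf_iff, intro allI impI)
  fix a y assume y: "y < \<phi> a + ereal (q a)"
  have "y - ereal (q a) < \<phi> a"
    using y by (cases "\<phi> a"; cases y) auto
  \<comment> \<open>\<open>d\<close> splits the gap: near \<open>a\<close>, \<open>\<phi>\<close>
    stays above \<open>d\<close> and \<open>q\<close> stays above \<open>y - d\<close>.\<close>
  then obtain d where d: "y - ereal (q a) < d" "d < \<phi> a"
    using dense by blast
  have "d < Liminf (at a) \<phi>"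
    using lsc d(2) unfolding lower_semicontinuous_def by (meson less_le_trans)
  then have 1: "eventually (\<lambda>x. \<phi> x > d) (at a)"
    by (rule less_LiminfD)
  have "((\<lambda>x. ereal (q x)) \<longlongrightarrow> ereal (q a)) (at a)"
    using q by (simp add: continuous_on_eq_continuous_at isContD)
  moreover have "y - d < ereal (q a)"
    using d by (cases y; cases d; cases "\<phi> a") auto
  ultimately have "eventually (\<lambda>x. y - d < ereal (q x)) (at a)"
    by (rule order_tendstoD)
  with 1 show "eventually (\<lambda>x. y < \<phi> x + ereal (q x)) (at a)"
  proof eventually_elim
    case (elim x)
    then show ?case using d
      by (cases y; cases d; cases "\<phi> x") auto
  qed
qed

text \<open>Direct method: compactness gives a minimizing sequence a limit in \<open>K\<close>, and
  lower semicontinuity compares the value there with the infimum, which may be infinite.\<close>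

lemma lower_semicontinuous_attains_Inf:
  fixes \<phi> :: "'a::metric_space \<Rightarrow> ereal"
  assumes lsc: "lower_semicontinuous \<phi>" and K: "compact K" "K \<noteq> {}"
  obtains p where "p \<in> K" "\<And>y. y \<in> K \<Longrightarrow> \<phi> p \<le> \<phi> y"
proof -
  obtain u where u: "\<And>n. u n \<in> \<phi> ` K" "u \<longlonglongrightarrow> Inf (\<phi> ` K)"
    using Inf_as_limit[of "\<phi> ` K"] K(2) by auto
  obtain X where X: "\<And>n. X n \<in> K" "\<And>n. u n = \<phi> (X n)"
    using u(1) unfolding image_iff by metis
  obtain p r where p: "p \<in> K" "strict_mono r" "(X \<circ> r) \<longlonglongrightarrow> p"
    using K(1) X(1) unfolding compact_def by metis
  have "\<phi> p \<le> Inf (\<phi> ` K)"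
    by (rule lower_semicontinuous_le_lim[OF lsc p(3), of "u \<circ> r"])
      (use u(2) p(2) X(2) in \<open>auto simp: LIMSEQ_subseq_LIMSEQ\<close>)
  then show thesis
    using that p(1) by (meson INF_lower order_trans)
qed

text \<open>The lower bound on the unit ball propagates along rays, which spares the separation theorem
  for an affine minorant.\<close>

lemma ereal_convex_growth:
  fixes \<phi> :: "'a::euclidean_space \<Rightarrow> ereal"
  assumes "proper \<phi>" "lower_semicontinuous \<phi>" "ereal_convex \<phi>" and a: "\<phi> x0 = ereal a"
  obtains D where "D \<ge> 0"
    "\<And>x. norm (x - x0) \<ge> 1 \<Longrightarrow> ereal (a - D * norm (x - x0)) \<le> \<phi> x"
proof -
  obtain p where p: "p \<in> cball x0 1" "\<And>y. y \<in> cball x0 1 \<Longrightarrow> \<phi> p \<le> \<phi> y"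
    using lower_semicontinuous_attains_Inf[OF assms(2), of "cball x0 1"] by auto
  have "\<phi> p \<le> ereal a" using p(2)[of x0] a by simp
  moreover have "\<phi> p \<noteq> -\<infinity>" using assms(1) by (simp add: proper_def)
  ultimately obtain m where m: "\<phi> p = ereal m" "m \<le> a" by (cases "\<phi> p") auto
  show thesis
  proof
    show "a - m \<ge> 0" using m by simp
    fix x assume r1: "norm (x - x0) \<ge> 1"
    define r where "r = norm (x - x0)"
    define y where "y = (1 - 1/r) *\<^sub>R x0 + (1/r) *\<^sub>R x"
    have r: "r \<ge> 1" using r1 r_def by simp
    have "y - x0 = (1/r) *\<^sub>R (x - x0)" by (simp add: y_def algebra_simps)
    then have "norm (y - x0) = 1" using r by (auto simp: r_def)
    then have "ereal m \<le> \<phi> y" using p(2)[of y] m by (simp add: dist_norm norm_minus_commute)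
    also have "\<phi> y \<le> ereal (1 - 1/r) * \<phi> x0 + ereal (1/r) * \<phi> x"
      unfolding y_def using assms(3) r unfolding ereal_convex_def by auto
    finally have *: "ereal m \<le> ereal ((1 - 1/r) * a) + ereal (1/r) * \<phi> x" by (simp add: a)
    show "ereal (a - (a - m) * norm (x - x0)) \<le> \<phi> x"
    proof (cases "\<phi> x")
      case (real t)
      have "m \<le> (1 - 1/r) * a + (1/r) * t" using * real by simp
      then have "r * m \<le> r * ((1 - 1/r) * a + (1/r) * t)" using r by simp
      also have "\<dots> = (r - 1) * a + t" using r by (simp add: field_simps)
      finally show ?thesis by (simp add: real flip: r_def) (simp add: algebra_simps)
    next
      case MInf
      then show ?thesis using assms(1) by (simp add: proper_def)
    qed simp
  qed
qed

text \<open>Outside a large ball the quadratic penalty outweighs the linear decrease of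
  \<open>\<phi>\<close> allowed by \<open>ereal_convex_growth\<close>, so minimizing over the
  compact ball is enough.\<close>

lemma prox_minimizes:
  fixes \<phi> :: "'a::euclidean_space \<Rightarrow> ereal" and z :: 'a
  assumes proper: "proper \<phi>" and lsc: "lower_semicontinuous \<phi>" and conv: "ereal_convex \<phi>"
    and \<gamma>: "\<gamma> > 0"
  defines "p \<equiv> prox \<gamma> \<phi> z"
  shows "\<phi> p + ereal (1 / (2 * \<gamma>) * (norm (p - z))\<^sup>2)
    \<le> \<phi> y + ereal (1 / (2 * \<gamma>) * (norm (y - z))\<^sup>2)"
proof -
  define \<psi> where "\<psi> = (\<lambda>x. \<phi> x + ereal (1 / (2 * \<gamma>) * (norm (x - z))\<^sup>2))"
  have lsc': "lower_semicontinuous \<psi>"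
    unfolding \<psi>_def by (intro lower_semicontinuous_add_continuous lsc continuous_intros)
  obtain x0 where "x0 \<in> eff_dom \<phi>" using proper by (auto simp: proper_def)
  moreover have "\<phi> x0 \<noteq> -\<infinity>" using proper by (simp add: proper_def)
  ultimately obtain a where a: "\<phi> x0 = ereal a"
    by (cases "\<phi> x0") (auto simp: eff_dom_def)
  obtain D where D: "D \<ge> 0"
    "\<And>x. norm (x - x0) \<ge> 1 \<Longrightarrow> ereal (a - D * norm (x - x0)) \<le> \<phi> x"
    using ereal_convex_growth[OF proper lsc conv a] by blast
  define s where "s = norm (x0 - z)"
  \<comment> \<open>For \<open>r \<ge> R\<close> the factor
    \<open>r - 2 * s - 2 * \<gamma> * D\<close> is nonnegative, which makes the penalty at distance
    \<open>r\<close> beat its value at \<open>x0\<close> by at least \<open>D * r\<close>. The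
    summand \<open>1\<close> puts such points in the range of the growth bound.\<close>
  define R where "R = 1 + 2 * s + 2 * \<gamma> * D"
  have s: "s \<ge> 0" by (simp add: s_def)
  have R: "R \<ge> 1" using s D \<gamma> by (simp add: R_def)
  obtain q where q: "q \<in> cball x0 R" "\<And>y. y \<in> cball x0 R \<Longrightarrow> \<psi> q \<le> \<psi> y"
    using lower_semicontinuous_attains_Inf[OF lsc', of "cball x0 R"] R by auto
  have "\<psi> q \<le> \<psi> y" for y
  proof (cases "y \<in> cball x0 R")
    case False
    define r where "r = norm (y - x0)"
    have r: "r \<ge> R" using False by (simp add: r_def dist_norm norm_minus_commute)
    have "norm (y - z) \<ge> r - s"
      using norm_triangle_ineq4[of "y - z" "x0 - z"] by (simp add: r_def s_def)
    moreover have "2 * \<gamma> * D \<ge> 0" using \<gamma> D(1) by simp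
    then have "r - s \<ge> 0" using r s unfolding R_def by linarith
    ultimately have "(norm (y - z))\<^sup>2 \<ge> (r - s)\<^sup>2"
      by (intro power_mono)
    moreover have "(r - s)\<^sup>2 \<ge> s\<^sup>2 + 2 * \<gamma> * (D * r)"
    proof -
      have "r * (r - 2 * s - 2 * \<gamma> * D) \<ge> 0" using r R R_def by simp
      then show ?thesis by (simp add: power2_eq_square algebra_simps)
    qed
    ultimately have "s\<^sup>2 + 2 * \<gamma> * (D * r) \<le> (norm (y - z))\<^sup>2" by linarith
    then have "(s\<^sup>2 + 2 * \<gamma> * (D * r)) / (2 * \<gamma>) \<le> (norm (y - z))\<^sup>2 / (2 * \<gamma>)"
      using \<gamma> by (intro divide_right_mono) auto
    then have "1 / (2 * \<gamma>) * s\<^sup>2 + D * r \<le> 1 / (2 * \<gamma>) * (norm (y - z))\<^sup>2"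
      using \<gamma> by (simp add: add_divide_distrib)
    then have "ereal (a + 1 / (2 * \<gamma>) * s\<^sup>2)
        \<le> ereal (a - D * r) + ereal (1 / (2 * \<gamma>) * (norm (y - z))\<^sup>2)" by simp
    also have "\<dots> \<le> \<psi> y"
      unfolding \<psi>_def using D(2)[of y] r R r_def by (intro add_right_mono) auto
    finally have "\<psi> x0 \<le> \<psi> y" by (simp add: \<psi>_def a s_def)
    moreover have "\<psi> q \<le> \<psi> x0" using R by (intro q) auto
    ultimately show ?thesis by (rule order_trans[rotated])
  qed (rule q)
  then have "is_arg_min \<psi> (\<lambda>_. True) q" by (simp add: is_arg_min_linorder)
  \<comment> \<open>\<open>prox\<close> is defined by choice, so the existence of the minimizer
    \<open>q\<close> is what makes \<open>p\<close> one.\<close>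
  then have "is_arg_min \<psi> (\<lambda>_. True) p"
    unfolding p_def prox_def arg_min_def \<psi>_def by (rule someI)
  then show ?thesis by (simp add: is_arg_min_linorder \<psi>_def)
qed

lemma prox_in_eff_dom:
  fixes \<phi> :: "'a::euclidean_space \<Rightarrow> ereal"
  assumes "proper \<phi>" "lower_semicontinuous \<phi>" "ereal_convex \<phi>" "\<gamma> > 0"
  shows "prox \<gamma> \<phi> z \<in> eff_dom \<phi>"
proof -
  obtain y where "y \<in> eff_dom \<phi>" using assms(1) by (auto simp: proper_def)
  then show ?thesis
    using prox_minimizes[OF assms, of z y] by (auto simp: eff_dom_def)
qed

text \<open>The hypothesis is what comparing a proximal point with the points at parameter \<open>t\<close> of a segment
  yields; \<open>k\<close> measures the failure of convexity.\<close>

lemma le_of_quadratic_perturbation: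
  fixes a b c e k :: real
  assumes "\<And>t. 0 < t \<Longrightarrow> t \<le> 1 \<Longrightarrow> a + t * b - t\<^sup>2 * c \<le> (1 - t) * a + t * e + k * (t * (1 - t))"
  shows "a + b - k \<le> e"
proof (rule tendsto_le[OF _ tendsto_const])
  show "((\<lambda>t. a + b - t * c - k * (1 - t)) \<longlongrightarrow> a + b - k) (at_right 0)"
    by (auto intro!: tendsto_eq_intros)
  have "eventually (\<lambda>t::real. t \<in> {0<..<1}) (at_right 0)"
    by (rule eventually_at_right_real) simp
  then show "eventually (\<lambda>t. a + b - t * c - k * (1 - t) \<le> e) (at_right 0)"
  proof eventually_elim
    case (elim t)
    have "t * (a + b - t * c - k * (1 - t)) \<le> t * e"
      using assms[of t] elim by (simp add: algebra_simps power2_eq_square)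
    then show ?case using elim by simp
  qed
qed simp

text \<open>Brings the penalty into the shape required by
  \<open>le_of_quadratic_perturbation\<close>: the coefficient linear in \<open>t\<close> exhibits
  the subgradient, and the remainder is of order \<open>t\<^sup>2\<close>.\<close>

lemma proximal_term_segment:
  fixes p w z :: "'a::real_inner"
  assumes "\<gamma> > 0"
  shows "1 / (2 * \<gamma>) * (norm ((1 - t) *\<^sub>R p + t *\<^sub>R w - z))\<^sup>2
    = 1 / (2 * \<gamma>) * (norm (p - z))\<^sup>2 - t * (((1/\<gamma>) *\<^sub>R (z - p)) \<bullet> (w - p))
      + t\<^sup>2 * (1 / (2 * \<gamma>) * (norm (w - p))\<^sup>2)"
proof -
  define u where "u = (1/\<gamma>) *\<^sub>R (z - p)"
  define d where "d = w - p"
  have pz: "p - z = - (\<gamma> *\<^sub>R u)" using assms by (simp add: u_def)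
  have "(1 - t) *\<^sub>R p + t *\<^sub>R w - z = t *\<^sub>R d + (p - z)" by (simp add: d_def algebra_simps)
  also have "\<dots> = t *\<^sub>R d - \<gamma> *\<^sub>R u" by (simp add: pz)
  finally have seg: "(1 - t) *\<^sub>R p + t *\<^sub>R w - z = t *\<^sub>R d - \<gamma> *\<^sub>R u" .
  have "(norm ((1 - t) *\<^sub>R p + t *\<^sub>R w - z))\<^sup>2
      = t\<^sup>2 * (norm d)\<^sup>2 - 2 * t * \<gamma> * (u \<bullet> d) + (norm (p - z))\<^sup>2"
    unfolding seg pz power2_norm_eq_inner
    by (simp add: inner_add_left inner_add_right inner_diff_left inner_diff_right
        inner_commute[of d u] power2_eq_square algebra_simps)
  then show ?thesis
    using assms unfolding u_def[symmetric] d_def[symmetric] by (simp add: field_simps)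
qed

text \<open>Minimality of \<open>p\<close> is tested on the segment from \<open>p\<close> to
  \<open>y\<close>. Since \<open>\<phi>\<close> is convex, the defect \<open>k\<close> of
  \<open>le_of_quadratic_perturbation\<close> is \<open>0\<close>.\<close>

lemma prox_subgradient:
  fixes \<phi> :: "'a::euclidean_space \<Rightarrow> ereal" and z :: 'a
  assumes proper: "proper \<phi>" and lsc: "lower_semicontinuous \<phi>" and conv: "ereal_convex \<phi>"
    and \<gamma>: "\<gamma> > 0"
  defines "p \<equiv> prox \<gamma> \<phi> z"
  shows "\<phi> p + ereal (((1/\<gamma>) *\<^sub>R (z - p)) \<bullet> (y - p)) \<le> \<phi> y"
proof -
  have notM: "\<phi> w \<noteq> -\<infinity>" for w using proper by (simp add: proper_def)
  have "p \<in> eff_dom \<phi>" unfolding p_def by (rule prox_in_eff_dom) fact+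
  with notM obtain a where a: "\<phi> p = ereal a"
    by (cases "\<phi> p") (auto simp: eff_dom_def)
  show ?thesis
  proof (cases "\<phi> y")
    case (real e)
    have "a + ((1/\<gamma>) *\<^sub>R (z - p)) \<bullet> (y - p) - 0 \<le> e"
    proof (rule le_of_quadratic_perturbation[where c = "1 / (2 * \<gamma>) * (norm (y - p))\<^sup>2"])
      fix t :: real assume t: "0 < t" "t \<le> 1"
      let ?w = "(1 - t) *\<^sub>R p + t *\<^sub>R y"
      have "ereal (a + 1 / (2 * \<gamma>) * (norm (p - z))\<^sup>2) \<le> \<phi> ?w + ereal (1 / (2 * \<gamma>) * (norm (?w - z))\<^sup>2)"
        using prox_minimizes[OF proper lsc conv \<gamma>, of z ?w] a by (simp add: p_def)
      also have "\<phi> ?w \<le> ereal (1 - t) * \<phi> p + ereal t * \<phi> y"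
        using conv t unfolding ereal_convex_def by auto
      finally have "a + 1 / (2 * \<gamma>) * (norm (p - z))\<^sup>2
          \<le> (1 - t) * a + t * e + 1 / (2 * \<gamma>) * (norm (?w - z))\<^sup>2"
        by (simp add: a real add_right_mono)
      then show "a + t * ((1/\<gamma>) *\<^sub>R (z - p) \<bullet> (y - p)) - t\<^sup>2 * (1 / (2 * \<gamma>) * (norm (y - p))\<^sup>2)
          \<le> (1 - t) * a + t * e + 0 * (t * (1 - t))"
        unfolding proximal_term_segment[OF \<gamma>] by linarith
    qed
    then show ?thesis by (simp add: a real)
  qed (use notM in auto)
qed

text \<open>With \<open>a\<close> and \<open>b\<close> the scaled residuals, \<open>a - v\<close>
  and \<open>b - v\<close> are subgradients of \<open>\<phi>\<close> at the two proximal points, so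
  monotonicity applies to them.\<close>

lemma prox_residual_antimono:
  fixes \<phi> :: "'a::euclidean_space \<Rightarrow> ereal"
  assumes proper: "proper \<phi>" and lsc: "lower_semicontinuous \<phi>" and conv: "ereal_convex \<phi>"
    and \<gamma>: "0 < \<gamma>" "\<gamma> \<le> \<delta>"
  shows "inverse \<delta> * norm (x - prox \<delta> \<phi> (x - \<delta> *\<^sub>R v))
    \<le> inverse \<gamma> * norm (x - prox \<gamma> \<phi> (x - \<gamma> *\<^sub>R v))"
proof -
  have \<delta>: "\<delta> > 0" using \<gamma> by simp
  define p where "p = prox \<gamma> \<phi> (x - \<gamma> *\<^sub>R v)"
  define q where "q = prox \<delta> \<phi> (x - \<delta> *\<^sub>R v)"
  define a where "a = (1/\<gamma>) *\<^sub>R (x - p)"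
  define b where "b = (1/\<delta>) *\<^sub>R (x - q)"
  have dom: "p \<in> eff_dom \<phi>" "q \<in> eff_dom \<phi>"
    unfolding p_def q_def by (rule prox_in_eff_dom; fact)+
  have notM: "\<phi> w \<noteq> -\<infinity>" for w using proper by (simp add: proper_def)
  from dom notM obtain s t where st: "\<phi> p = ereal s" "\<phi> q = ereal t"
    by (cases "\<phi> p"; cases "\<phi> q") (auto simp: eff_dom_def)
  have "(1/\<gamma>) *\<^sub>R (x - \<gamma> *\<^sub>R v - p) = a - v" "(1/\<delta>) *\<^sub>R (x - \<delta> *\<^sub>R v - q) = b - v"
    using \<gamma> \<delta> by (simp_all add: a_def b_def algebra_simps)
  then have "s + (a - v) \<bullet> (q - p) \<le> t" "t + (b - v) \<bullet> (p - q) \<le> s"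
    using prox_subgradient[OF proper lsc conv \<gamma>(1), of "x - \<gamma> *\<^sub>R v" q]
      prox_subgradient[OF proper lsc conv \<delta>, of "x - \<delta> *\<^sub>R v" p] st
    by (simp_all add: p_def q_def)
  moreover have "(a - v) \<bullet> (q - p) + (b - v) \<bullet> (p - q) = - ((a - b) \<bullet> (p - q))"
    by (simp add: inner_diff_left inner_diff_right)
  \<comment> \<open>monotonicity of the subdifferential; the rest uses only \<open>p - q = \<delta> b - \<gamma> a\<close>\<close>
  ultimately have "(a - b) \<bullet> (p - q) \<ge> 0" by linarith
  moreover have "p - q = \<delta> *\<^sub>R b - \<gamma> *\<^sub>R a" using \<gamma> \<delta> by (simp add: a_def b_def)
  ultimately have "\<gamma> * (a \<bullet> a) + \<delta> * (b \<bullet> b) \<le> (\<gamma> + \<delta>) * (a \<bullet> b)"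
    by (simp add: inner_diff_left inner_diff_right inner_commute[of b a] algebra_simps)
  also have "\<dots> \<le> (\<gamma> + \<delta>) * (norm a * norm b)"
    using \<gamma> norm_cauchy_schwarz[of a b] by (intro mult_left_mono) auto
  \<comment> \<open>Cauchy-Schwarz reduces the vector inequality to one that factors. If
    \<open>norm a < norm b\<close>, the first factor is negative and the second positive because
    \<open>\<gamma> \<le> \<delta>\<close>.\<close>
  finally have "0 \<le> (norm a - norm b) * (\<delta> * norm b - \<gamma> * norm a)"
    by (simp add: power2_norm_eq_inner[symmetric] power2_eq_square algebra_simps)
  then have "norm b \<le> norm a"
  proof (rule contrapos_pp)
    assume *: "\<not> norm b \<le> norm a"
    then have "\<gamma> * norm a \<le> \<delta> * norm a" "\<delta> * norm a < \<delta> * norm b"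
      using \<gamma> \<delta> by (auto intro: mult_right_mono)
    then have "\<delta> * norm b - \<gamma> * norm a > 0" by linarith
    with * show "\<not> 0 \<le> (norm a - norm b) * (\<delta> * norm b - \<gamma> * norm a)"
      by (simp add: mult_neg_pos not_le)
  qed
  then show ?thesis
    using \<gamma> \<delta> by (simp add: a_def b_def p_def q_def divide_inverse)
qed

subsection \<open>Smooth functions\<close>

text \<open>\<open>grad\<close> is a definite description, so uniqueness has to be shown; it follows
  by evaluating both derivatives in the direction \<open>w - v\<close>.\<close>

lemma grad_eq:
  assumes "GDERIV F x :> v"
  shows "grad F x = v"
  unfolding grad_def
proof (rule the_equality)
  show "GDERIV F x :> v" by fact
  fix w assume "GDERIV F x :> w"
  then have "(\<lambda>h. h \<bullet> w) = (\<lambda>h. h \<bullet> v)"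
    using assms unfolding gderiv_def by (rule has_derivative_unique)
  then have "(w - v) \<bullet> w = (w - v) \<bullet> v" by metis
  then have "(w - v) \<bullet> (w - v) = 0" by (simp add: inner_diff_right)
  then show "w = v" by simp
qed

text \<open>Riesz representation: the adjoint of the functional \<open>F'\<close>, evaluated at
  \<open>1\<close>, is the representing vector.\<close>

lemma has_derivative_imp_GDERIV:
  fixes F :: "'a::euclidean_space \<Rightarrow> real"
  assumes "(F has_derivative F') (at x)"
  obtains v where "GDERIV F x :> v" "\<And>d. F' d = d \<bullet> v"
proof
  have F': "linear F'" using assms by (rule has_derivative_linear)
  show *: "F' d = d \<bullet> adjoint F' 1" for d
    using adjoint_works[OF F', of d 1] by simp
  then show "GDERIV F x :> adjoint F' 1"
    using assms unfolding gderiv_def by (simp flip: *)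
qed

lemma GDERIV_quotient_tendsto:
  fixes F :: "'a::euclidean_space \<Rightarrow> real"
  assumes "GDERIV F x :> v"
  shows "((\<lambda>y. (F y - F x - v \<bullet> (y - x)) / norm (y - x)) \<longlongrightarrow> 0) (at x)"
proof -
  have "((\<lambda>y. norm (F y - F x - (y - x) \<bullet> v) / norm (y - x)) \<longlongrightarrow> 0) (at x)"
    using assms unfolding gderiv_def by (simp add: has_derivative_iff_norm)
  then have "((\<lambda>y. norm ((F y - F x - v \<bullet> (y - x)) / norm (y - x))) \<longlongrightarrow> 0) (at x)"
    by (simp add: inner_commute)
  then show ?thesis by (rule tendsto_norm_zero_cancel)
qed

text \<open>For \<open>v\<close> the difference quotient tends to \<open>0\<close>. For any other
  \<open>w\<close>, approaching \<open>x\<close> along the ray in direction \<open>w - v\<close>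
  drives the quotient to \<open>- norm (w - v)\<close>, so the lower limit is negative.\<close>

lemma regular_subdiff_GDERIV:
  fixes F :: "'a::euclidean_space \<Rightarrow> real"
  assumes F: "GDERIV F x :> v"
  shows "regular_subdiff (\<lambda>y. ereal (F y)) x = {v}"
proof -
  let ?q = "\<lambda>w y. (F y - F x - w \<bullet> (y - x)) / norm (y - x)"
  have q: "(ereal (F y) - ereal (F x) - ereal (w \<bullet> (y - x))) / ereal (norm (y - x)) = ereal (?q w y)"
    if "y \<noteq> x" for w y using that by simp
  \<comment> \<open>Away from \<open>x\<close> the extended quotient is a real one, and
    \<open>Liminf (at x)\<close> does not see the division by zero at \<open>x\<close>.\<close>
  have mem: "w \<in> regular_subdiff (\<lambda>y. ereal (F y)) x
      \<longleftrightarrow> 0 \<le> Liminf (at x) (\<lambda>y. ereal (?q w y))" for w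
  proof -
    have "Liminf (at x) (\<lambda>y. (ereal (F y) - ereal (F x) - ereal (w \<bullet> (y - x))) / ereal (norm (y - x)))
      = Liminf (at x) (\<lambda>y. ereal (?q w y))"
      by (rule Liminf_eq) (simp only: eventually_at_filter q, simp)
    then show ?thesis unfolding regular_subdiff_def by (simp add: eff_dom_def)
  qed
  have lim: "((\<lambda>y. ?q v y) \<longlongrightarrow> 0) (at x)" by (rule GDERIV_quotient_tendsto[OF F])
  have "Liminf (at x) (\<lambda>y. ereal (?q v y)) = 0"
    using lim by (intro lim_imp_Liminf) (auto simp: zero_ereal_def)
  then have "v \<in> regular_subdiff (\<lambda>y. ereal (F y)) x" by (simp add: mem)
  moreover have "w = v" if "w \<in> regular_subdiff (\<lambda>y. ereal (F y)) x" for w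
  proof (rule ccontr)
    assume "w \<noteq> v"
    define e where "e = norm (w - v)"
    have e: "e > 0" using \<open>w \<noteq> v\<close> by (simp add: e_def)
    have "ereal (- (e / 2)) < Liminf (at x) (\<lambda>y. ereal (?q w y))"
      using that e unfolding mem by (auto intro: less_le_trans[where y = 0])
    \<comment> \<open>The two thresholds \<open>e / 2\<close> add up to a strict bound by
      \<open>e * norm (y - x)\<close>, whereas on the ray the left side equals it.\<close>
    then have 1: "eventually (\<lambda>y. - (e / 2) < ?q w y) (at x)"
      by (auto dest: less_LiminfD)
    have 2: "eventually (\<lambda>y. ?q v y < e / 2) (at x)"
      using lim e by (intro order_tendstoD) auto
    have "eventually (\<lambda>y. (w - v) \<bullet> (y - x) < e * norm (y - x)) (at x)"
      using 1 2 eventually_neq_at_within[of x x UNIV]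
    proof eventually_elim
      case (elim y)
      have n: "norm (y - x) > 0" using elim by simp
      have "?q v y - ?q w y = ((w - v) \<bullet> (y - x)) / norm (y - x)"
        by (simp add: diff_divide_distrib[symmetric] inner_diff_left)
      then have "((w - v) \<bullet> (y - x)) / norm (y - x) < e" using elim by linarith
      then show ?case using n by (simp add: field_simps)
    qed
    moreover have "filterlim (\<lambda>t. x + t *\<^sub>R (w - v)) (at x) (at_right (0::real))"
      unfolding filterlim_at using \<open>w \<noteq> v\<close>
      by (auto intro!: tendsto_eq_intros simp: eventually_at_filter)
    ultimately have "eventually (\<lambda>t. (w - v) \<bullet> (x + t *\<^sub>R (w - v) - x)
        < e * norm (x + t *\<^sub>R (w - v) - x)) (at_right 0)"
      by (rule eventually_compose_filterlim)
    moreover have "eventually (\<lambda>t::real. t > 0) (at_right 0)"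
      by (simp add: eventually_at_filter)
    ultimately have "eventually (\<lambda>t::real. False) (at_right 0)"
    proof eventually_elim
      case (elim t)
      then show ?case
        by (simp add: e_def power2_norm_eq_inner[symmetric] power2_eq_square)
    qed
    then show False by simp
  qed
  ultimately show ?thesis by blast
qed

text \<open>Regular subgradients near \<open>x\<close> are values of \<open>G\<close>, so continuity
  of \<open>G\<close> collapses all their limits to \<open>G x\<close>. This turns the infimum in
  the stationarity measure into a single residual.\<close>

lemma general_subdiff_C1:
  fixes F :: "'a::euclidean_space \<Rightarrow> real"
  assumes F: "\<And>y. GDERIV F y :> G y" and G: "continuous_on UNIV G"
  shows "general_subdiff (\<lambda>y. ereal (F y)) x = {G x}"
proof -
  have "v = G x" if "xs \<longlonglongrightarrow> x" "\<And>n. vs n = G (xs n)" "vs \<longlonglongrightarrow> v" for v xs vs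
  proof -
    have "(\<lambda>n. G (xs n)) \<longlonglongrightarrow> G x"
      using G that(1) by (simp add: continuous_on_eq_continuous_at isCont_tendsto_compose)
    moreover have "vs = (\<lambda>n. G (xs n))" using that(2) by auto
    ultimately show ?thesis using that(3) LIMSEQ_unique by blast
  qed
  moreover have "\<exists>xs vs. xs \<longlonglongrightarrow> x \<and> (\<lambda>n. ereal (F (xs n))) \<longlonglongrightarrow> ereal (F x)
      \<and> (\<forall>n. vs n = G (xs n)) \<and> vs \<longlonglongrightarrow> G x"
    by (rule exI[of _ "\<lambda>_. x"], rule exI[of _ "\<lambda>_. G x"]) simp
  ultimately show ?thesis
    unfolding general_subdiff_def regular_subdiff_GDERIV[OF F] by (auto simp: eff_dom_def)
qed

lemma stationarity_measure_C1:
  fixes F :: "'a::euclidean_space \<Rightarrow> real"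
  assumes "\<And>y. GDERIV F y :> G y" "continuous_on UNIV G"
  shows "stationarity_measure \<gamma> F \<phi> x
    = ereal (inverse \<gamma> * norm (x - prox \<gamma> \<phi> (x - \<gamma> *\<^sub>R G x)))"
  unfolding stationarity_measure_def general_subdiff_C1[OF assms] by simp

subsection \<open>Moreau envelopes of Lipschitz functions\<close>

text \<open>Farther than \<open>2 * K * \<mu>\<close> from \<open>z\<close> the penalty exceeds the
  largest decrease \<open>K * norm (w - z)\<close> of \<open>g\<close>, so the minimum over that
  closed ball is global; the ball radius is also the distance bound.\<close>

lemma moreau_envelope_attained:
  fixes g :: "'z::euclidean_space \<Rightarrow> real"
  assumes g: "K-lipschitz_on UNIV g" and \<mu>: "\<mu> > 0"
  obtains p where "moreau_envelope \<mu> g z = g p + 1 / (2 * \<mu>) * (norm (p - z))\<^sup>2"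
    "\<And>w. g p + 1 / (2 * \<mu>) * (norm (p - z))\<^sup>2 \<le> g w + 1 / (2 * \<mu>) * (norm (w - z))\<^sup>2"
    "norm (z - p) \<le> 2 * K * \<mu>"
proof -
  have K: "K \<ge> 0" using g by (rule lipschitz_on_nonneg)
  define \<psi> where "\<psi> = (\<lambda>w. g w + 1 / (2 * \<mu>) * (norm (w - z))\<^sup>2)"
  have far: "\<psi> z < \<psi> w" if "norm (w - z) > 2 * K * \<mu>" for w
  proof -
    have n: "norm (w - z) > 0" using that K \<mu> by (smt (verit) mult_nonneg_nonneg)
    have "g z - g w \<le> K * norm (w - z)"
      using lipschitz_onD[OF g, of z w] by (simp add: dist_norm norm_minus_commute)
    moreover have "2 * \<mu> * (K * norm (w - z)) < (norm (w - z))\<^sup>2"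
      using mult_strict_right_mono[OF that n] by (simp add: power2_eq_square algebra_simps)
    then have "K * norm (w - z) < 1 / (2 * \<mu>) * (norm (w - z))\<^sup>2"
      using \<mu> by (simp add: field_simps)
    ultimately show ?thesis by (simp add: \<psi>_def)
  qed
  have cont: "continuous_on A \<psi>" for A
    unfolding \<psi>_def
    by (intro continuous_intros lipschitz_on_continuous_on[OF lipschitz_on_subset[OF g]]) auto
  obtain p where p: "p \<in> cball z (2 * K * \<mu>)" "\<And>w. w \<in> cball z (2 * K * \<mu>) \<Longrightarrow> \<psi> p \<le> \<psi> w"
    using continuous_attains_inf[of "cball z (2 * K * \<mu>)" \<psi>] cont mult_nonneg_nonneg[of K \<mu>] K \<mu>
    by (force simp: not_less)
  have min: "\<psi> p \<le> \<psi> w" for w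
  proof (cases "w \<in> cball z (2 * K * \<mu>)")
    case False
    then have "\<psi> z < \<psi> w" by (intro far) (simp add: dist_norm norm_minus_commute)
    moreover have "\<psi> p \<le> \<psi> z" using K \<mu> by (intro p) auto
    ultimately show ?thesis by simp
  qed (rule p)
  have "moreau_envelope \<mu> g z = \<psi> p"
    unfolding moreau_envelope_def \<psi>_def[symmetric]
    by (rule cInf_eq_minimum) (use min in \<open>auto simp: \<psi>_def\<close>)
  then show thesis
    using that[of p] min p(1) by (simp add: \<psi>_def dist_norm)
qed

lemma moreau_envelope_le:
  fixes g :: "'z::euclidean_space \<Rightarrow> real"
  assumes "K-lipschitz_on UNIV g" and "\<mu> > 0"
  shows "moreau_envelope \<mu> g z \<le> g w + 1 / (2 * \<mu>) * (norm (w - z))\<^sup>2"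
  using moreau_envelope_attained[OF assms, of z] by metis

text \<open>From \<open>z\<close> to the minimizer, at distance at most
  \<open>2 * K * \<mu>\<close>, \<open>g\<close> drops by at most \<open>K\<close> times that
  distance, and the penalty is nonnegative.\<close>

lemma moreau_envelope_ge:
  fixes g :: "'z::euclidean_space \<Rightarrow> real"
  assumes g: "K-lipschitz_on UNIV g" and \<mu>: "\<mu> > 0"
  shows "g z - 2 * K\<^sup>2 * \<mu> \<le> moreau_envelope \<mu> g z"
proof -
  obtain p where p: "moreau_envelope \<mu> g z = g p + 1 / (2 * \<mu>) * (norm (p - z))\<^sup>2"
    "norm (z - p) \<le> 2 * K * \<mu>"
    using moreau_envelope_attained[OF g \<mu>, of z] by metis
  have "g z - g p \<le> K * norm (z - p)"
    using lipschitz_onD[OF g, of z p] by (simp add: dist_norm)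
  also have "\<dots> \<le> K * (2 * K * \<mu>)"
    using p(2) lipschitz_on_nonneg[OF g] by (rule mult_left_mono)
  finally have "g z - 2 * K\<^sup>2 * \<mu> \<le> g p" by (simp add: power2_eq_square)
  also have "\<dots> \<le> moreau_envelope \<mu> g z" using \<mu> by (simp add: p(1))
  finally show ?thesis .
qed

text \<open>The minimizer for \<open>\<mu>\<close> is a trial point for \<open>\<mu>'\<close>. It
  costs only the increase of the penalty, controlled by the distance bound and the ratio
  \<open>\<mu> / \<mu>' \<le> M\<close>. A multiple of \<open>\<mu> - \<mu>'\<close> is wanted
  because it telescopes.\<close>

lemma moreau_envelope_index_change:
  fixes g :: "'z::euclidean_space \<Rightarrow> real"
  assumes g: "K-lipschitz_on UNIV g" and \<mu>: "0 < \<mu>'" "\<mu>' \<le> \<mu>" and M: "\<mu> \<le> M * \<mu>'"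
  shows "moreau_envelope \<mu>' g z \<le> moreau_envelope \<mu> g z + 2 * K\<^sup>2 * M * (\<mu> - \<mu>')"
proof -
  have \<mu>0: "\<mu> > 0" using \<mu> by simp
  obtain p where p: "moreau_envelope \<mu> g z = g p + 1 / (2 * \<mu>) * (norm (p - z))\<^sup>2"
    "norm (z - p) \<le> 2 * K * \<mu>"
    using moreau_envelope_attained[OF g \<mu>0, of z] by metis
  have d: "1 / (2 * \<mu>') - 1 / (2 * \<mu>) = (\<mu> - \<mu>') / (2 * \<mu> * \<mu>')"
    using \<mu> \<mu>0 by (simp add: field_simps)
  have "(1 / (2 * \<mu>') - 1 / (2 * \<mu>)) * (norm (p - z))\<^sup>2 \<le> (\<mu> - \<mu>') / (2 * \<mu> * \<mu>') * (2 * K * \<mu>)\<^sup>2"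
    unfolding d using \<mu> \<mu>0 p(2)
    by (intro mult_left_mono power_mono) (auto simp: norm_minus_commute)
  also have "\<dots> = 2 * K\<^sup>2 * (\<mu> - \<mu>') * (\<mu> / \<mu>')"
    using \<mu> \<mu>0 by (simp add: power2_eq_square field_simps)
  also have "\<dots> \<le> 2 * K\<^sup>2 * (\<mu> - \<mu>') * M"
    using \<mu> M by (intro mult_left_mono) (auto simp: divide_le_eq)
  finally have "1 / (2 * \<mu>') * (norm (p - z))\<^sup>2
      \<le> 1 / (2 * \<mu>) * (norm (p - z))\<^sup>2 + 2 * K\<^sup>2 * M * (\<mu> - \<mu>')"
    by (simp only: left_diff_distrib) (simp add: mult_ac)
  then show ?thesis
    using moreau_envelope_le[OF g \<mu>(1), of z p] p(1) by linarith
qed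

text \<open>Same segment argument as \<open>prox_subgradient\<close>, with \<open>k\<close> equal to
  \<open>\<eta> / 2 * (norm (w - p))\<^sup>2\<close>: subtracting the quadratic from the convex
  function leaves exactly this defect.\<close>

lemma weakly_convex_prox_subgradient:
  fixes g :: "'z::euclidean_space \<Rightarrow> real"
  assumes g: "weakly_convex \<eta> g" and \<mu>: "\<mu> > 0"
    and min: "\<And>w. g p + 1 / (2 * \<mu>) * (norm (p - z))\<^sup>2 \<le> g w + 1 / (2 * \<mu>) * (norm (w - z))\<^sup>2"
  shows "g p + ((1/\<mu>) *\<^sub>R (z - p)) \<bullet> (w - p) - \<eta> / 2 * (norm (w - p))\<^sup>2 \<le> g w"
proof (rule le_of_quadratic_perturbation[where c = "1 / (2 * \<mu>) * (norm (w - p))\<^sup>2"])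
  fix t :: real assume t: "0 < t" "t \<le> 1"
  let ?w = "(1 - t) *\<^sub>R p + t *\<^sub>R w"
  have "g ?w + \<eta> / 2 * (norm ?w)\<^sup>2
      \<le> (1 - t) * (g p + \<eta> / 2 * (norm p)\<^sup>2) + t * (g w + \<eta> / 2 * (norm w)\<^sup>2)"
    using g t unfolding weakly_convex_def by (intro convex_onD) auto
  moreover have "(norm ?w)\<^sup>2 = (1 - t) * (norm p)\<^sup>2 + t * (norm w)\<^sup>2 - t * (1 - t) * (norm (w - p))\<^sup>2"
    by (simp add: power2_norm_eq_inner inner_add_left inner_add_right inner_diff_left
        inner_diff_right inner_commute[of w p] algebra_simps)
  then have "\<eta> / 2 * (norm ?w)\<^sup>2 = (1 - t) * (\<eta> / 2 * (norm p)\<^sup>2) + t * (\<eta> / 2 * (norm w)\<^sup>2)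
      - \<eta> / 2 * (norm (w - p))\<^sup>2 * (t * (1 - t))"
    by (simp only:) (simp add: field_simps)
  ultimately have "g ?w \<le> (1 - t) * g p + t * g w + \<eta> / 2 * (norm (w - p))\<^sup>2 * (t * (1 - t))"
    unfolding distrib_left by linarith
  moreover have "g p + 1 / (2 * \<mu>) * (norm (p - z))\<^sup>2 \<le> g ?w + 1 / (2 * \<mu>) * (norm (?w - z))\<^sup>2"
    by (rule min)
  ultimately show "g p + t * ((1/\<mu>) *\<^sub>R (z - p) \<bullet> (w - p)) - t\<^sup>2 * (1 / (2 * \<mu>) * (norm (w - p))\<^sup>2)
      \<le> (1 - t) * g p + t * g w + \<eta> / 2 * (norm (w - p))\<^sup>2 * (t * (1 - t))"
    unfolding proximal_term_segment[OF \<mu>] by linarith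
qed

lemma GDERIV_of_quadratic_bound:
  fixes F :: "'a::real_inner \<Rightarrow> real"
  assumes "\<And>y. \<bar>F y - F x - u \<bullet> (y - x)\<bar> \<le> C * (norm (y - x))\<^sup>2"
  shows "GDERIV F x :> u"
  unfolding gderiv_def has_derivative_iff_norm
proof (intro conjI)
  show "bounded_linear (\<lambda>h. h \<bullet> u)" by (rule bounded_linear_inner_left)
  have lim: "((\<lambda>y. C * norm (y - x)) \<longlongrightarrow> 0) (at x)"
    by (auto intro!: tendsto_eq_intros)
  have "norm (norm (F y - F x - (y - x) \<bullet> u) / norm (y - x)) \<le> C * norm (y - x)"
    if "y \<noteq> x" for y
  proof -
    have "norm (y - x) > 0" using that by simp
    then show ?thesis
      using assms[of y] by (simp add: inner_commute[of u] pos_divide_le_eq power2_eq_square mult.assoc)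
  qed
  then have "eventually (\<lambda>y. norm (norm (F y - F x - (y - x) \<bullet> u) / norm (y - x)) \<le> C * norm (y - x)) (at x)"
    unfolding eventually_at_filter by (intro always_eventually allI impI)
  then show "((\<lambda>y. norm (F y - F x - (y - x) \<bullet> u) / norm (y - x)) \<longlongrightarrow> 0) (at x)"
    using lim by (rule Lim_null_comparison)
qed

text \<open>A two-sided quadratic bound around \<open>z\<close> yields the gradient. The upper side
  tests the envelope at \<open>y\<close> with the minimizer \<open>p\<close> for \<open>z\<close>;
  the lower side applies the weak subgradient inequality at \<open>p\<close> to the minimizer for
  \<open>y\<close>.\<close>

lemma moreau_envelope_GDERIV:
  fixes g :: "'z::euclidean_space \<Rightarrow> real"
  assumes g: "K-lipschitz_on UNIV g" and wc: "weakly_convex \<eta> g" and \<eta>: "\<eta> > 0"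
    and \<mu>: "0 < \<mu>" "\<mu> \<le> inverse (2 * \<eta>)"
  obtains p u where "GDERIV (moreau_envelope \<mu> g) z :> u" "u = (1/\<mu>) *\<^sub>R (z - p)"
    "norm (z - p) \<le> 2 * K * \<mu>" "norm u \<le> 2 * K"
    "\<And>w. g p + u \<bullet> (w - p) - \<eta> / 2 * (norm (w - p))\<^sup>2 \<le> g w"
proof -
  obtain p where p: "moreau_envelope \<mu> g z = g p + 1 / (2 * \<mu>) * (norm (p - z))\<^sup>2"
    "\<And>w. g p + 1 / (2 * \<mu>) * (norm (p - z))\<^sup>2 \<le> g w + 1 / (2 * \<mu>) * (norm (w - z))\<^sup>2"
    "norm (z - p) \<le> 2 * K * \<mu>"
    using moreau_envelope_attained[OF g \<mu>(1), of z] by blast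
  define u where "u = (1/\<mu>) *\<^sub>R (z - p)"
  have sub: "g p + u \<bullet> (w - p) - \<eta> / 2 * (norm (w - p))\<^sup>2 \<le> g w" for w
    unfolding u_def by (rule weakly_convex_prox_subgradient[OF wc \<mu>(1) p(2)])
  \<comment> \<open>This is where \<open>\<mu> \<le> inverse (2 * \<eta>)\<close> enters: half of
    the penalty coefficient absorbs the weak convexity defect.\<close>
  have \<eta>\<mu>: "\<eta> / 2 \<le> 1 / (4 * \<mu>)" using \<mu> \<eta> by (simp add: field_simps)
  have zp: "z - p = \<mu> *\<^sub>R u" using \<mu> by (simp add: u_def)
  \<comment> \<open>Expands the penalty around \<open>p\<close> and \<open>z\<close> via
    \<open>w - y = (w - p) - (y - z) - \<mu> *\<^sub>R u\<close>.\<close>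
  have shift: "1 / (2 * \<mu>) * (norm (w - y))\<^sup>2
      = 1 / (2 * \<mu>) * (norm (p - z))\<^sup>2 + u \<bullet> (y - z) - u \<bullet> (w - p)
        + 1 / (2 * \<mu>) * (norm ((w - p) - (y - z)))\<^sup>2" for w y
  proof -
    define d e where "d = w - p" and "e = y - z"
    have "w - y = (d - e) - \<mu> *\<^sub>R u" by (simp add: d_def e_def flip: zp)
    moreover have "(norm (a - b))\<^sup>2 = (norm a)\<^sup>2 - 2 * (b \<bullet> a) + (norm b)\<^sup>2" for a b :: 'z
      by (simp add: power2_norm_eq_inner inner_diff_left inner_diff_right inner_commute[of a b])
    ultimately have "(norm (w - y))\<^sup>2 = (norm (d - e))\<^sup>2 - 2 * \<mu> * (u \<bullet> (d - e)) + (norm (\<mu> *\<^sub>R u))\<^sup>2"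
      by simp
    then have "1 / (2 * \<mu>) * (norm (w - y))\<^sup>2
        = 1 / (2 * \<mu>) * (norm (d - e))\<^sup>2 - u \<bullet> (d - e) + 1 / (2 * \<mu>) * (norm (\<mu> *\<^sub>R u))\<^sup>2"
      using \<mu>(1) by (simp only:) (simp add: field_simps)
    then show ?thesis
      unfolding norm_minus_commute[of p z] zp d_def[symmetric] e_def[symmetric]
      by (simp add: inner_diff_right)
  qed
  have "\<bar>moreau_envelope \<mu> g y - moreau_envelope \<mu> g z - u \<bullet> (y - z)\<bar>
      \<le> 1 / (2 * \<mu>) * (norm (y - z))\<^sup>2" for y
  proof -
    have up: "moreau_envelope \<mu> g y \<le> moreau_envelope \<mu> g z + u \<bullet> (y - z) + 1 / (2 * \<mu>) * (norm (y - z))\<^sup>2"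
      using moreau_envelope_le[OF g \<mu>(1), of y p] shift[of p y] p(1)
      by (simp add: norm_minus_commute)
    obtain w where w: "moreau_envelope \<mu> g y = g w + 1 / (2 * \<mu>) * (norm (w - y))\<^sup>2"
      using moreau_envelope_attained[OF g \<mu>(1), of y] by metis
    define d e where "d = w - p" and "e = y - z"
    \<comment> \<open>The defect, quadratic in \<open>d\<close>, is traded for the penalty in
      \<open>d - e\<close>, which cancels against \<open>shift\<close>, and an admissible error in
      \<open>e\<close>.\<close>
    have "norm d \<le> norm (d - e) + norm e" by (metis diff_add_cancel norm_triangle_ineq)
    then have "(norm d)\<^sup>2 \<le> (norm (d - e) + norm e)\<^sup>2" by (intro power_mono) auto
    also have "\<dots> \<le> 2 * (norm (d - e))\<^sup>2 + 2 * (norm e)\<^sup>2"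
      using sum_squares_bound[of "norm (d - e)" "norm e"] by (simp add: power2_sum)
    finally have "1 / (4 * \<mu>) * (norm d)\<^sup>2 \<le> 1 / (2 * \<mu>) * (norm (d - e))\<^sup>2 + 1 / (2 * \<mu>) * (norm e)\<^sup>2"
      using \<mu> by (simp add: field_simps)
    moreover have "\<eta> / 2 * (norm d)\<^sup>2 \<le> 1 / (4 * \<mu>) * (norm d)\<^sup>2"
      using \<eta>\<mu> by (intro mult_right_mono) auto
    moreover have "g p + u \<bullet> d - \<eta> / 2 * (norm d)\<^sup>2 \<le> g w" using sub[of w] by (simp add: d_def)
    moreover have "1 / (2 * \<mu>) * (norm (w - y))\<^sup>2 = 1 / (2 * \<mu>) * (norm (p - z))\<^sup>2 + u \<bullet> e - u \<bullet> d
        + 1 / (2 * \<mu>) * (norm (d - e))\<^sup>2"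
      using shift[of w y] by (simp add: d_def e_def)
    ultimately have "moreau_envelope \<mu> g z + u \<bullet> e - 1 / (2 * \<mu>) * (norm e)\<^sup>2 \<le> moreau_envelope \<mu> g y"
      using w p(1) by linarith
    then show ?thesis using up unfolding e_def by linarith
  qed
  then have "GDERIV (moreau_envelope \<mu> g) z :> u" by (rule GDERIV_of_quadratic_bound)
  moreover have "norm u \<le> 2 * K" using p(3) \<mu> unfolding zp by simp
  ultimately show thesis using that u_def p(3) sub by blast
qed

subsection \<open>The variable smoothing iteration\<close>

text \<open>Chain rule tested against a direction \<open>d\<close>, so that the adjoint of
  \<open>S'\<close> need not be named.\<close>

lemma composite_gradient:
  fixes h :: "'a::euclidean_space \<Rightarrow> real" and e :: "'b::euclidean_space \<Rightarrow> real"
  assumes h: "GDERIV h y :> a" and S: "(S has_derivative S') (at y)" and e: "GDERIV e (S y) :> u"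
  defines "F \<equiv> \<lambda>y. h y + e (S y)"
  shows "GDERIV F y :> grad F y" "d \<bullet> grad F y = d \<bullet> a + S' d \<bullet> u"
proof -
  have "((\<lambda>y. e (S y)) has_derivative (\<lambda>d. S' d \<bullet> u)) (at y)"
    using has_derivative_compose[OF S e[unfolded gderiv_def]] .
  then have F: "(F has_derivative (\<lambda>d. d \<bullet> a + S' d \<bullet> u)) (at y)"
    unfolding F_def using h unfolding gderiv_def by (intro has_derivative_add)
  obtain v where v: "GDERIV F y :> v" "\<And>d. d \<bullet> a + S' d \<bullet> u = d \<bullet> v"
    using has_derivative_imp_GDERIV[OF F] by metis
  show "GDERIV F y :> grad F y" "d \<bullet> grad F y = d \<bullet> a + S' d \<bullet> u"
    using v by (simp_all add: grad_eq[OF v(1)])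
qed

text \<open>\<open>f - G\<close> is minimal at \<open>xs\<close> and \<open>- v\<close> is a
  subgradient of \<open>\<phi>\<close> there, so the quotient of \<open>f + \<phi>\<close> for the
  vector \<open>0\<close> dominates the first-order error quotient of \<open>G\<close>, which tends
  to \<open>0\<close>.\<close>

lemma stationary_point_of_minorant:
  fixes f G :: "'a::euclidean_space \<Rightarrow> real"
  assumes G: "GDERIV G xs :> v" "\<And>y. G y - G xs \<le> f y - f xs"
    and \<phi>: "\<phi> xs = ereal s" "\<And>y. ereal (s - v \<bullet> (y - xs)) \<le> \<phi> y"
  shows "stationary_point (\<lambda>y. ereal (f y) + \<phi> y) xs"
proof -
  let ?J = "\<lambda>y. ereal (f y) + \<phi> y"
  let ?E = "\<lambda>y. (G y - G xs - v \<bullet> (y - xs)) / norm (y - xs)"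
  have "Liminf (at xs) (\<lambda>y. ereal (?E y)) = 0"
    using GDERIV_quotient_tendsto[OF G(1)] by (intro lim_imp_Liminf) (auto simp: zero_ereal_def)
  moreover have "Liminf (at xs) (\<lambda>y. ereal (?E y))
      \<le> Liminf (at xs) (\<lambda>y. (?J y - ?J xs - ereal (0 \<bullet> (y - xs))) / ereal (norm (y - xs)))"
  proof (rule Liminf_mono)
    have "ereal (?E y) \<le> (?J y - ?J xs - ereal (0 \<bullet> (y - xs))) / ereal (norm (y - xs))"
      if "y \<noteq> xs" for y
    proof (cases "\<phi> y")
      case (real t)
      then have "G y - G xs - v \<bullet> (y - xs) \<le> f y + t - (f xs + s)"
        using G(2)[of y] \<phi>(2)[of y] by simp
      then show ?thesis using that by (simp add: real \<phi>(1) divide_right_mono)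
    next
      case PInf
      then show ?thesis using that by (simp add: \<phi>(1))
    next
      case MInf
      then show ?thesis using \<phi>(2)[of y] by simp
    qed
    then show "eventually (\<lambda>y. ereal (?E y)
        \<le> (?J y - ?J xs - ereal (0 \<bullet> (y - xs))) / ereal (norm (y - xs))) (at xs)"
      unfolding eventually_at_filter by (intro always_eventually allI impI)
  qed
  moreover have dom: "xs \<in> eff_dom ?J" by (simp add: eff_dom_def \<phi>(1))
  ultimately have "0 \<in> regular_subdiff ?J xs" by (simp add: regular_subdiff_def)
  \<comment> \<open>Constant sequences show that a regular subgradient is a general one.\<close>
  then have "\<exists>ys vs. ys \<longlonglongrightarrow> xs \<and> (\<lambda>n. ?J (ys n)) \<longlonglongrightarrow> ?J xs
      \<and> (\<forall>n. vs n \<in> regular_subdiff ?J (ys n)) \<and> vs \<longlonglongrightarrow> 0"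
    by - (rule exI[of _ "\<lambda>_. xs"], rule exI[of _ "\<lambda>_. 0"], simp)
  then show ?thesis
    using dom unfolding stationary_point_def general_subdiff_def by simp
qed

text \<open>If \<open>a\<close> stayed above \<open>e\<close> from \<open>N\<close> on, the descent
  would pay \<open>e * \<mu> n\<close> at every step, and the lower bound \<open>B\<close> would
  bound the partial sums of \<open>\<mu>\<close>.\<close>

lemma descent_weights_diverge_imp_small:
  fixes \<Phi> a \<mu> :: "nat \<Rightarrow> real"
  assumes descent: "\<And>n. n \<ge> 1 \<Longrightarrow> \<Phi> (Suc n) \<le> \<Phi> n - \<mu> n * a n"
    and below: "\<And>n. n \<ge> 1 \<Longrightarrow> B \<le> \<Phi> n" and \<mu>: "\<And>n. n \<ge> 1 \<Longrightarrow> \<mu> n \<ge> 0"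
    and div: "filterlim (\<lambda>N. \<Sum>n=1..N. \<mu> n) at_top sequentially" and e: "e > 0"
  shows "\<exists>n\<ge>N. a n < e"
proof (rule ccontr)
  assume "\<not> (\<exists>n\<ge>N. a n < e)"
  then have a: "a n \<ge> e" if "n \<ge> N" for n using that by (meson not_less)
  \<comment> \<open>The index is shifted because the descent step with weight \<open>\<mu> n\<close>
    ends at \<open>\<Phi> (Suc n)\<close>.\<close>
  define T where "T = (\<lambda>n. \<Phi> (Suc n) + e * (\<Sum>k=1..n. \<mu> k))"
  have "T n \<le> T N" if "n \<ge> N" for n
    using that
  proof (induction n rule: dec_induct)
    case (step n)
    have "\<mu> (Suc n) * e \<le> \<mu> (Suc n) * a (Suc n)"
      using step.hyps by (intro mult_left_mono a \<mu>) auto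
    then have "T (Suc n) \<le> T n"
      using descent[of "Suc n"] by (simp add: T_def algebra_simps)
    then show ?case using step.IH by simp
  qed simp
  then have "(\<Sum>k=1..n. \<mu> k) \<le> (T N - B) / e" if "n \<ge> N" for n
    using that below[of "Suc n"] e by (fastforce simp: T_def field_simps)
  moreover have "eventually (\<lambda>n. (\<Sum>k=1..n. \<mu> k) > (T N - B) / e) sequentially"
    using div by (rule filterlim_at_top_dense[THEN iffD1, rule_format])
  ultimately show False
    unfolding eventually_sequentially by (meson linear not_less)
qed

text \<open>Isolates the limit passage from the algorithm: \<open>u l\<close> and \<open>p l\<close>
  stand for the envelope gradients and the proximal points of \<open>g\<close>, and the stepsize is
  fixed, as in the measure at \<open>\<gamma>bar\<close>.\<close>

lemma prox_gradient_limit_stationary: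
  fixes \<phi> :: "'x::euclidean_space \<Rightarrow> ereal" and h :: "'x \<Rightarrow> real"
    and S :: "'x \<Rightarrow> 'z::euclidean_space" and g :: "'z \<Rightarrow> real"
    and S' :: "'x \<Rightarrow> 'x \<Rightarrow>\<^sub>L 'z"
  assumes proper: "proper \<phi>" and lsc: "lower_semicontinuous \<phi>" and conv: "ereal_convex \<phi>"
    and h: "\<And>y. GDERIV h y :> grad h y" and h_lip: "K'-lipschitz_on (eff_dom \<phi>) (grad h)"
    and S: "\<And>y. (S has_derivative blinfun_apply (S' y)) (at y)" "continuous_on UNIV S'"
    and g: "continuous_on UNIV g" and \<gamma>: "\<gamma> > 0"
    and X: "\<And>l. X l \<in> eff_dom \<phi>" "X \<longlonglongrightarrow> xs"
    and u: "bounded (range u)"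
    and sub: "\<And>l w. g (p l) + u l \<bullet> (w - p l) - \<eta> / 2 * (norm (w - p l))\<^sup>2 \<le> g w"
    and p: "(\<lambda>l. S (X l) - p l) \<longlonglongrightarrow> 0"
    and v: "\<And>l d. d \<bullet> v l = d \<bullet> grad h (X l) + S' (X l) d \<bullet> u l"
    and res: "(\<lambda>l. norm (X l - prox \<gamma> \<phi> (X l - \<gamma> *\<^sub>R v l))) \<longlonglongrightarrow> 0"
  shows "stationary_point (\<lambda>y. ereal (h y + g (S y)) + \<phi> y) xs"
proof -
  have notM: "\<phi> w \<noteq> -\<infinity>" for w using proper by (simp add: proper_def)
  obtain uu r where r: "strict_mono r" "(u \<circ> r) \<longlonglongrightarrow> uu"
    using bounded_imp_convergent_subsequence[OF u] by auto
  define Y where "Y = X \<circ> r"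
  have Y: "\<And>l. Y l \<in> eff_dom \<phi>" "Y \<longlonglongrightarrow> xs"
    using X r(1) by (auto simp: Y_def LIMSEQ_subseq_LIMSEQ)
  define P where "P = (\<lambda>l. prox \<gamma> \<phi> (Y l - \<gamma> *\<^sub>R v (r l)))"
  have "(\<lambda>l. norm (Y l - P l)) \<longlonglongrightarrow> 0"
    using LIMSEQ_subseq_LIMSEQ[OF res r(1)] by (simp add: P_def Y_def o_def)
  then have YP: "(\<lambda>l. Y l - P l) \<longlonglongrightarrow> 0" by (rule tendsto_norm_zero_cancel)
  have P: "P \<longlonglongrightarrow> xs" using tendsto_diff[OF Y(2) YP] by simp
  have "continuous_on UNIV S"
    using has_derivative_continuous[OF S(1)] by (simp add: continuous_on_eq_continuous_at)
  then have SY: "(\<lambda>l. S (Y l)) \<longlonglongrightarrow> S xs"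
    using Y(2) by (simp add: continuous_on_eq_continuous_at isCont_tendsto_compose)
  have "(\<lambda>l. S (Y l) - p (r l)) \<longlonglongrightarrow> 0"
    using LIMSEQ_subseq_LIMSEQ[OF p r(1)] by (simp add: Y_def o_def)
  from tendsto_diff[OF SY this] have pr: "(\<lambda>l. p (r l)) \<longlonglongrightarrow> S xs" by simp
  have gp: "(\<lambda>l. g (p (r l))) \<longlonglongrightarrow> g (S xs)"
    by (rule isCont_tendsto_compose[OF _ pr]) (use g in \<open>simp add: continuous_on_eq_continuous_at\<close>)
  have ur: "(\<lambda>l. u (r l)) \<longlonglongrightarrow> uu" using r(2) by (simp add: o_def)
  have gsub: "g (S xs) + uu \<bullet> (w - S xs) - \<eta> / 2 * (norm (w - S xs))\<^sup>2 \<le> g w" for w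
  proof (rule tendsto_upperbound)
    show "(\<lambda>l. g (p (r l)) + u (r l) \<bullet> (w - p (r l)) - \<eta> / 2 * (norm (w - p (r l)))\<^sup>2)
        \<longlonglongrightarrow> g (S xs) + uu \<bullet> (w - S xs) - \<eta> / 2 * (norm (w - S xs))\<^sup>2"
      by (intro tendsto_intros gp ur pr)
    show "eventually (\<lambda>l. g (p (r l)) + u (r l) \<bullet> (w - p (r l))
        - \<eta> / 2 * (norm (w - p (r l)))\<^sup>2 \<le> g w) sequentially"
      by (intro always_eventually allI sub)
  qed simp
  \<comment> \<open>That \<open>xs\<close> lies in the domain, where \<open>grad h\<close> is continuous, is only known after passing to
    the limit; the Lipschitz condition provides a limit \<open>D\<close> beforehand.\<close>
  have "Cauchy (\<lambda>l. grad h (Y l))"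
    using lipschitz_on_uniformly_continuous[OF h_lip] LIMSEQ_imp_Cauchy[OF Y(2)] Y(1)
    by (rule uniformly_continuous_on_Cauchy)
  then obtain D where D: "(\<lambda>l. grad h (Y l)) \<longlonglongrightarrow> D"
    using convergent_eq_Cauchy by (auto simp: convergent_def Cauchy_convergent_iff)
  have S'Y: "(\<lambda>l. S' (Y l)) \<longlonglongrightarrow> S' xs"
    using Y(2) S(2) by (simp add: continuous_on_eq_continuous_at isCont_tendsto_compose)
  \<comment> \<open>The limit is taken along the proximal points \<open>P\<close>, where the
    subgradients of \<open>\<phi>\<close> live; they share the limit \<open>xs\<close> of
    \<open>Y\<close> because the residual vanishes.\<close>
  have ineq: "\<phi> xs \<le> ereal (t + (y - xs) \<bullet> D + S' xs (y - xs) \<bullet> uu)" if t: "\<phi> y = ereal t" for y t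
  proof (rule lower_semicontinuous_le_lim[OF lsc P])
    let ?c = "\<lambda>l. t - ((1/\<gamma>) *\<^sub>R (Y l - P l)) \<bullet> (y - P l) + (y - P l) \<bullet> grad h (Y l)
        + S' (Y l) (y - P l) \<bullet> u (r l)"
    have "?c \<longlonglongrightarrow> t - ((1/\<gamma>) *\<^sub>R 0) \<bullet> (y - xs) + (y - xs) \<bullet> D + S' xs (y - xs) \<bullet> uu"
      by (intro tendsto_intros YP P D ur S'Y bounded_bilinear.tendsto[OF bounded_bilinear_blinfun_apply])
    then show "(\<lambda>l. ereal (?c l)) \<longlonglongrightarrow> ereal (t + (y - xs) \<bullet> D + S' xs (y - xs) \<bullet> uu)" by simp
    show "\<phi> (P l) \<le> ereal (?c l)" for l
    proof -
      have "(1/\<gamma>) *\<^sub>R (Y l - \<gamma> *\<^sub>R v (r l) - P l) = (1/\<gamma>) *\<^sub>R (Y l - P l) - v (r l)"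
        using \<gamma> by (simp add: algebra_simps)
      then have "\<phi> (P l) + ereal (((1/\<gamma>) *\<^sub>R (Y l - P l) - v (r l)) \<bullet> (y - P l)) \<le> ereal t"
        using prox_subgradient[OF proper lsc conv \<gamma>, of "Y l - \<gamma> *\<^sub>R v (r l)" y] t
        by (simp add: P_def)
      moreover have "((1/\<gamma>) *\<^sub>R (Y l - P l) - v (r l)) \<bullet> (y - P l) = t - ?c l"
        using v[of "y - P l" "r l"]
        by (simp add: inner_diff_left[of _ "v (r l)"] inner_commute[of "v (r l)"] Y_def)
      ultimately have "\<phi> (P l) + ereal (t - ?c l) \<le> ereal t" by simp
      then show ?thesis by (cases "\<phi> (P l)") auto
    qed
  qed
  \<comment> \<open>One point with a finite value makes the bound \<open>ineq\<close> finite, which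
    places \<open>xs\<close> in the domain and identifies \<open>D\<close>.\<close>
  obtain y0 t0 where "\<phi> y0 = ereal t0"
  proof -
    obtain y where "\<phi> y < \<infinity>" using proper by (auto simp: proper_def eff_dom_def)
    then show thesis using that[of y] notM[of y] by (cases "\<phi> y") auto
  qed
  from ineq[OF this] notM[of xs] obtain s where s: "\<phi> xs = ereal s" by (cases "\<phi> xs") auto
  then have "xs \<in> eff_dom \<phi>" by (simp add: eff_dom_def)
  then have "(\<lambda>l. grad h (Y l)) \<longlonglongrightarrow> grad h xs"
    using continuous_on_tendsto_compose[OF lipschitz_on_continuous_on[OF h_lip] Y(2)] Y(1) by simp
  then have D_eq: "D = grad h xs" using D LIMSEQ_unique by blast
  \<comment> \<open>\<open>G\<close> is \<open>h\<close> plus the minorant of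
    \<open>g \<circ> S\<close> from \<open>gsub\<close>, up to a constant. Its quadratic term has
    zero derivative at \<open>xs\<close>, so only \<open>grad h xs\<close> and \<open>uu\<close>
    contribute to the gradient.\<close>
  define G where "G = (\<lambda>y. h y + uu \<bullet> S y - \<eta> / 2 * (norm (S y - S xs))\<^sup>2)"
  have dG: "(G has_derivative (\<lambda>d. d \<bullet> grad h xs + uu \<bullet> S' xs d)) (at xs)"
  proof -
    have diff: "((\<lambda>y. S y - S xs) has_derivative (\<lambda>d. S' xs d - 0)) (at xs)"
      by (rule has_derivative_diff[OF S(1) has_derivative_const])
    show ?thesis
      unfolding G_def power2_norm_eq_inner
      using has_derivative_diff[OF
          has_derivative_add[OF h[unfolded gderiv_def] has_derivative_inner_right[OF S(1)]]
          has_derivative_mult_right[OF has_derivative_inner[OF diff diff], of "\<eta> / 2"]]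
      by simp
  qed
  then obtain vv where vv: "GDERIV G xs :> vv" "\<And>d. d \<bullet> grad h xs + uu \<bullet> S' xs d = d \<bullet> vv"
    using has_derivative_imp_GDERIV[OF dG] by metis
  show ?thesis
  proof (rule stationary_point_of_minorant)
    show "GDERIV G xs :> vv" "\<phi> xs = ereal s" by fact+
    show "G y - G xs \<le> (h y + g (S y)) - (h xs + g (S xs))" for y
      using gsub[of "S y"] by (simp add: G_def inner_diff_right)
    show "ereal (s - vv \<bullet> (y - xs)) \<le> \<phi> y" for y
    proof (cases "\<phi> y")
      case (real t)
      then show ?thesis
        using ineq[OF real] vv(2)[of "y - xs"]
        by (simp add: s D_eq inner_commute[of vv] inner_commute[of uu])
    qed (use notM in auto)
  qed
qed

theorem mainTheorem2:
  fixes \<phi> :: "'x::euclidean_space \<Rightarrow> ereal"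
    and h :: "'x \<Rightarrow> real"
    and S :: "'x \<Rightarrow> 'z::euclidean_space"
    and g :: "'z \<Rightarrow> real"
    and f :: "'x \<Rightarrow> real"
    and fn :: "nat \<Rightarrow> 'x \<Rightarrow> real"
    and x :: "nat \<Rightarrow> 'x"
    and \<mu> \<gamma> L :: "nat \<Rightarrow> real"
    and \<eta> c M \<omega>1 \<omega>2 \<beta> \<gamma>bar :: real
  assumes phi_proper: "proper \<phi>"
    and phi_lsc: "lower_semicontinuous \<phi>"
    and phi_convex: "ereal_convex \<phi>"
    and h_diff: "h differentiable_on UNIV"
    and h_grad_lipschitz: "\<exists>K. K-lipschitz_on (eff_dom \<phi>) (grad h)"
    and S_C1: "continuously_differentiable S"
    and g_lipschitz: "\<exists>K. K-lipschitz_on UNIV g"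
    and eta_pos: "\<eta> > 0"
    and g_weakly_convex: "weakly_convex \<eta> g"
    and f_def: "f = (\<lambda>y. h y + g (S y))"
    and bounded_below: "(INF y \<in> eff_dom \<phi>. ereal (f y) + \<phi> y) > -\<infinity>"
    and x1_dom: "x 1 \<in> eff_dom \<phi>"
    and c_range: "0 < c" "c < 1"
    and mu_range: "\<And>n. n \<ge> 1 \<Longrightarrow> 0 < \<mu> n \<and> \<mu> n \<le> inverse (2 * \<eta>)"
    and mu_lim: "\<mu> \<longlonglongrightarrow> 0"
    and mu_sum: "filterlim (\<lambda>N. \<Sum>n=1..N. \<mu> n) at_top sequentially"
    and M_ge: "M \<ge> 1"
    and mu_ratio: "\<And>n. n \<ge> 1 \<Longrightarrow> inverse M \<le> \<mu> (Suc n) / \<mu> n \<and> \<mu> (Suc n) / \<mu> n \<le> 1"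
    and fn_def: "\<And>n. n \<ge> 1 \<Longrightarrow> fn n = (\<lambda>y. h y + moreau_envelope (\<mu> n) g (S y))"
    and gamma_pos: "\<And>n. n \<ge> 1 \<Longrightarrow> \<gamma> n > 0"
    and iteration: "\<And>n. n \<ge> 1 \<Longrightarrow>
          x (Suc n) = prox (\<gamma> n) \<phi> (x n - \<gamma> n *\<^sub>R grad (fn n) (x n))"
    and omega_pos: "\<omega>1 > 0" "\<omega>2 > 0"
    and L_def: "\<And>n. n \<ge> 1 \<Longrightarrow> L n = \<omega>1 + \<omega>2 * inverse (\<mu> n)"
    and fn_grad_lipschitz: "\<And>n. n \<ge> 1 \<Longrightarrow> (L n)-lipschitz_on UNIV (grad (fn n))"
    and beta_pos: "\<beta> > 0"
    and armijo: "\<And>n. n \<ge> 1 \<Longrightarrow>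
          (let p = prox (\<gamma> n) \<phi> (x n - \<gamma> n *\<^sub>R grad (fn n) (x n))
           in ereal (fn n p) + \<phi> p
              \<le> ereal (fn n (x n)) + \<phi> (x n)
                - ereal (c * \<gamma> n) * (stationarity_measure (\<gamma> n) (fn n) \<phi> (x n))\<^sup>2)"
    and gamma_lower: "\<And>n. n \<ge> 1 \<Longrightarrow> \<gamma> n \<ge> \<beta> * inverse (L n)"
    and gamma_bdd: "bdd_above (\<gamma> ` {1..})"
    and gammabar_def: "\<gamma>bar = (SUP n \<in> {1..}. \<gamma> n)"
  shows "liminf (\<lambda>n. stationarity_measure \<gamma>bar (fn n) \<phi> (x n)) = 0
    \<and> (\<exists>m :: nat \<Rightarrow> nat. strict_mono_on {1..} m \<and> m ` {1..} \<subseteq> {1..} \<and>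
          (\<lambda>l. stationarity_measure \<gamma>bar (fn (m l)) \<phi> (x (m l))) \<longlonglongrightarrow> 0)
    \<and> (\<forall>m :: nat \<Rightarrow> nat. strict_mono_on {1..} m \<and> m ` {1..} \<subseteq> {1..} \<and>
          (\<lambda>l. stationarity_measure \<gamma>bar (fn (m l)) \<phi> (x (m l))) \<longlonglongrightarrow> 0 \<longrightarrow>
          (\<forall>xstar. cluster_point (\<lambda>l. x (m l)) xstar \<longrightarrow>
             stationary_point (\<lambda>y. ereal (f y) + \<phi> y) xstar))"
proof -

  \<comment> \<open>Gradients of the smoothed functions and the residual\<close>
  obtain K where g_lip: "K-lipschitz_on UNIV g" using g_lipschitz by blast
  obtain K' where h_lip: "K'-lipschitz_on (eff_dom \<phi>) (grad h)" using h_grad_lipschitz by blast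
  obtain S' :: "'x \<Rightarrow> 'x \<Rightarrow>\<^sub>L 'z" where S': "\<And>y. (S has_derivative blinfun_apply (S' y)) (at y)"
    "continuous_on UNIV S'"
    using S_C1 unfolding continuously_differentiable_def by blast
  have notM: "\<phi> w \<noteq> -\<infinity>" for w using phi_proper by (simp add: proper_def)
  have h_grad: "GDERIV h y :> grad h y" for y
  proof -
    obtain h' where "(h has_derivative h') (at y)"
      using h_diff by (auto simp: differentiable_on_def differentiable_def)
    then obtain v where "GDERIV h y :> v" using has_derivative_imp_GDERIV by blast
    then show ?thesis using grad_eq by metis
  qed
  have \<mu>_pos: "\<mu> n > 0" if "n \<ge> 1" for n using mu_range[OF that] by simp
  have \<mu>_le: "\<mu> n \<le> inverse (2 * \<eta>)" if "n \<ge> 1" for n using mu_range[OF that] by simp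
  \<comment> \<open>Bundles proximal point and envelope gradient so that both can be chosen
    simultaneously along a subsequence.\<close>
  define Q where "Q = (\<lambda>n z p u. GDERIV (moreau_envelope (\<mu> n) g) z :> u
      \<and> norm (z - p) \<le> 2 * K * \<mu> n \<and> norm u \<le> 2 * K
      \<and> (\<forall>w. g p + u \<bullet> (w - p) - \<eta> / 2 * (norm (w - p))\<^sup>2 \<le> g w))"
  have Q_ex: "\<exists>p u. Q n z p u" if n: "n \<ge> 1" for n z
    using moreau_envelope_GDERIV[OF g_lip g_weakly_convex eta_pos \<mu>_pos[OF n] \<mu>_le[OF n], of z]
    unfolding Q_def by metis
  have fn_grad: "GDERIV (fn n) y :> grad (fn n) y" if n: "n \<ge> 1" for n y
    using Q_ex[OF n, of "S y"] composite_gradient(1)[OF h_grad S'(1)]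
    unfolding fn_def[OF n] Q_def by blast
  have fn_grad_inner: "d \<bullet> grad (fn n) y = d \<bullet> grad h y + S' y d \<bullet> u"
    if n: "n \<ge> 1" and "Q n (S y) p u" for n y p u d
    using composite_gradient(2)[OF h_grad S'(1)] that(2) unfolding fn_def[OF n] Q_def by blast
  define \<rho> where "\<rho> = (\<lambda>\<delta> n. inverse \<delta> * norm (x n - prox \<delta> \<phi> (x n - \<delta> *\<^sub>R grad (fn n) (x n))))"
  have measure: "stationarity_measure \<delta> (fn n) \<phi> (x n) = ereal (\<rho> \<delta> n)" if n: "n \<ge> 1" for \<delta> n
    unfolding \<rho>_def
    by (rule stationarity_measure_C1[OF fn_grad[OF n] lipschitz_on_continuous_on[OF fn_grad_lipschitz[OF n]]])
  have \<gamma>_le: "\<gamma> n \<le> \<gamma>bar" if "n \<ge> 1" for n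
    unfolding gammabar_def using gamma_bdd that by (intro cSUP_upper) auto
  have \<gamma>bar: "\<gamma>bar > 0" using \<gamma>_le[of 1] gamma_pos[of 1] by simp
  have \<rho>_nonneg: "\<rho> \<gamma>bar n \<ge> 0" for n using \<gamma>bar by (simp add: \<rho>_def)
  have \<rho>_le: "\<rho> \<gamma>bar n \<le> \<rho> (\<gamma> n) n" if n: "n \<ge> 1" for n
    unfolding \<rho>_def
    by (rule prox_residual_antimono[OF phi_proper phi_lsc phi_convex gamma_pos[OF n] \<gamma>_le[OF n]])
  have x_dom: "x n \<in> eff_dom \<phi>" if "n \<ge> 1" for n
    using that
  proof (induction n rule: dec_induct)
    case (step n)
    then show ?case
      using iteration[of n] prox_in_eff_dom[OF phi_proper phi_lsc phi_convex gamma_pos[of n]] by simp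
  qed (rule x1_dom)
  define \<phi>r where "\<phi>r = (\<lambda>n. real_of_ereal (\<phi> (x n)))"
  have \<phi>r: "\<phi> (x n) = ereal (\<phi>r n)" if "n \<ge> 1" for n
    using x_dom[OF that] notM[of "x n"] unfolding \<phi>r_def eff_dom_def by (cases "\<phi> (x n)") auto

  \<comment> \<open>The Lyapunov function and its descent\<close>
  obtain B where B: "ereal B < (INF y \<in> eff_dom \<phi>. ereal (f y) + \<phi> y)"
    using bounded_below ereal_dense2 by blast
  have f_ge: "B \<le> f (x n) + \<phi>r n" if "n \<ge> 1" for n
    using less_le_trans[OF B INF_lower[OF x_dom[OF that]]] \<phi>r[OF that] by simp

  \<comment> \<open>\<open>C\<close> has two roles: it is the constant of
    \<open>moreau_envelope_index_change\<close>, and being at least \<open>2 * K\<^sup>2\<close> it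
    compensates the smoothing error in the lower bound for \<open>\<Phi>\<close>.\<close>
  define C where "C = 2 * K\<^sup>2 * M"
  have C: "C \<ge> 2 * K\<^sup>2" using M_ge by (simp add: C_def mult_le_cancel_left1)
  define \<Phi> where "\<Phi> = (\<lambda>n. fn n (x n) + \<phi>r n + C * \<mu> n)"
  \<comment> \<open>Since \<open>L n * \<mu> n = \<omega>1 * \<mu> n + \<omega>2\<close> is at most
    this denominator, \<open>\<beta> * inverse (L n)\<close> is at least
    \<open>\<kappa> * \<mu> n\<close>.\<close>
  define \<kappa> where "\<kappa> = \<beta> / (\<omega>1 * inverse (2 * \<eta>) + \<omega>2)"
  have den: "\<omega>1 * inverse (2 * \<eta>) + \<omega>2 > 0" using omega_pos eta_pos by (simp add: add_pos_pos)
  have \<kappa>: "\<kappa> > 0" using den beta_pos by (simp add: \<kappa>_def)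
  have \<gamma>_ge: "\<kappa> * \<mu> n \<le> \<gamma> n" if n: "n \<ge> 1" for n
  proof -
    have "L n * \<mu> n \<le> \<omega>1 * inverse (2 * \<eta>) + \<omega>2" and Lp: "L n > 0"
      using \<mu>_pos[OF n] mult_left_mono[OF \<mu>_le[OF n], of \<omega>1] omega_pos L_def[OF n]
      by (simp_all add: distrib_right add_pos_pos mult.assoc)
    moreover have "L n * \<mu> n > 0" using Lp \<mu>_pos[OF n] by simp
    ultimately have "\<kappa> \<le> \<beta> / (L n * \<mu> n)"
      unfolding \<kappa>_def using beta_pos by (intro divide_left_mono) auto
    then have "\<kappa> * \<mu> n \<le> \<beta> / (L n * \<mu> n) * \<mu> n"
      using \<mu>_pos[OF n] by (intro mult_right_mono) auto
    also have "\<dots> = \<beta> * inverse (L n)" using \<mu>_pos[OF n] by (simp add: field_simps)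
    finally show ?thesis using gamma_lower[OF n] by simp
  qed
  have descent: "\<Phi> (Suc n) \<le> \<Phi> n - \<mu> n * (c * \<kappa> * (\<rho> \<gamma>bar n)\<^sup>2)" if n: "n \<ge> 1" for n
  proof -
    have ratio: "\<mu> (Suc n) \<le> \<mu> n" "\<mu> n \<le> M * \<mu> (Suc n)"
      using mu_ratio[OF n] \<mu>_pos[OF n] M_ge by (simp_all add: field_simps)
    have "fn n (x (Suc n)) + \<phi>r (Suc n) \<le> fn n (x n) + \<phi>r n - c * \<gamma> n * (\<rho> (\<gamma> n) n)\<^sup>2"
      using armijo[OF n] iteration[OF n] \<phi>r[of "Suc n"] \<phi>r[OF n] measure[OF n]
      by (simp add: Let_def power2_eq_square)
    moreover have "fn (Suc n) (x (Suc n)) \<le> fn n (x (Suc n)) + C * (\<mu> n - \<mu> (Suc n))"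
      using moreau_envelope_index_change[OF g_lip \<mu>_pos[of "Suc n"] ratio]
      unfolding fn_def[OF n] fn_def[of "Suc n", simplified] C_def by simp
    moreover have "\<mu> n * (c * \<kappa> * (\<rho> \<gamma>bar n)\<^sup>2) \<le> c * \<gamma> n * (\<rho> (\<gamma> n) n)\<^sup>2"
    proof -
      have "c * (\<kappa> * \<mu> n) * (\<rho> \<gamma>bar n)\<^sup>2 \<le> c * \<gamma> n * (\<rho> (\<gamma> n) n)\<^sup>2"
        using \<gamma>_ge[OF n] \<rho>_le[OF n] \<rho>_nonneg c_range gamma_pos[OF n] \<kappa> \<mu>_pos[OF n]
        by (intro mult_mono power_mono mult_left_mono) auto
      then show ?thesis by (simp add: mult_ac)
    qed
    ultimately show ?thesis unfolding \<Phi>_def by (simp add: algebra_simps)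
  qed
  have below: "B \<le> \<Phi> n" if n: "n \<ge> 1" for n
  proof -
    have "f (x n) - C * \<mu> n \<le> f (x n) - 2 * K\<^sup>2 * \<mu> n"
      using mult_right_mono[OF C, of "\<mu> n"] \<mu>_pos[OF n] by simp
    also have "\<dots> \<le> fn n (x n)"
      using moreau_envelope_ge[OF g_lip \<mu>_pos[OF n], of "S (x n)"] by (simp add: f_def fn_def[OF n])
    finally show ?thesis using f_ge[OF n] by (simp add: \<Phi>_def)
  qed
  have small: "\<exists>n\<ge>N. \<rho> \<gamma>bar n < e" if e: "e > 0" for e N
  proof -
    have ck: "c * \<kappa> > 0" using c_range \<kappa> by simp
    then have "c * \<kappa> * e\<^sup>2 > 0" using e by simp
    then obtain n where "n \<ge> N" "c * \<kappa> * (\<rho> \<gamma>bar n)\<^sup>2 < c * \<kappa> * e\<^sup>2"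
      using descent_weights_diverge_imp_small[of \<Phi> \<mu> "\<lambda>n. c * \<kappa> * (\<rho> \<gamma>bar n)\<^sup>2" B "c * \<kappa> * e\<^sup>2" N]
        descent below \<mu>_pos mu_sum by (meson less_imp_le)
    then have "(\<rho> \<gamma>bar n)\<^sup>2 < e\<^sup>2" using ck by (simp only: mult_less_cancel_left_pos)
    then have "\<rho> \<gamma>bar n < e" by (rule power2_less_imp_less) (use e in simp)
    then show ?thesis using \<open>n \<ge> N\<close> by blast
  qed

  \<comment> \<open>The limit inferior and the vanishing subsequence\<close>
  let ?m = "\<lambda>n. stationarity_measure \<gamma>bar (fn n) \<phi> (x n)"
  have liminf0: "liminf ?m = 0"
  proof (rule antisym)
    show "0 \<le> liminf ?m"
      by (rule Liminf_bounded, rule eventually_sequentiallyI[of 1]) (simp add: measure \<rho>_nonneg)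
    show "liminf ?m \<le> 0"
    proof (rule ccontr)
      assume "\<not> liminf ?m \<le> 0"
      then have "0 < liminf ?m" by simp
      then obtain e where e: "0 < ereal e" "ereal e < liminf ?m" using ereal_dense2 by blast
      then obtain N where N: "\<And>n. n \<ge> N \<Longrightarrow> ereal e < ?m n"
        using less_LiminfD[OF e(2)] unfolding eventually_sequentially by blast
      obtain n where "n \<ge> max N 1" "\<rho> \<gamma>bar n < e" using small[of e "max N 1"] e by auto
      then show False using N[of n] measure[of n \<gamma>bar] by simp
    qed
  qed
  moreover have "\<exists>m. strict_mono_on {1..} m \<and> m ` {1..} \<subseteq> {1..} \<and> (\<lambda>l. ?m (m l)) \<longlonglongrightarrow> 0"
  proof -
    obtain r :: "nat \<Rightarrow> nat" where r: "strict_mono r" "(?m \<circ> r) \<longlonglongrightarrow> liminf ?m"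
      using liminf_subseq_lim by blast
    \<comment> \<open>This keeps positive indices positive, so \<open>r\<close> itself serves as
      \<open>m\<close>.\<close>
    have "l \<le> r l" for l by (rule seq_suble[OF r(1)])
    then have "r ` {1..} \<subseteq> {1..}" by (auto intro: order_trans)
    moreover have "strict_mono_on {1..} r" using r(1) by (simp add: strict_mono_on_def strict_mono_def)
    ultimately show ?thesis using r(2) unfolding liminf0 o_def by blast
  qed

  \<comment> \<open>Stationarity of cluster points\<close>
  moreover have "stationary_point (\<lambda>y. ereal (f y) + \<phi> y) xs"
    if m: "strict_mono_on {1..} m" "m ` {1..} \<subseteq> {1..}" "(\<lambda>l. ?m (m l)) \<longlonglongrightarrow> 0"
      and cl: "cluster_point (\<lambda>l. x (m l)) xs" for m :: "nat \<Rightarrow> nat" and xs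
  proof -
    obtain r :: "nat \<Rightarrow> nat" where r: "strict_mono r" "(\<lambda>l. x (m (r l))) \<longlonglongrightarrow> xs"
      using cl unfolding cluster_point_def o_def by blast
    \<comment> \<open>The shift by \<open>Suc\<close> avoids \<open>r 0\<close>, which may be
      \<open>0\<close>, where nothing is known about \<open>m\<close>.\<close>
    define k where "k = (\<lambda>l. m (r (Suc l)))"
    have r1: "r (Suc l) \<ge> 1" for l
      using seq_suble[OF r(1), of "Suc l"] by simp
    have k1: "k l \<ge> 1" for l using m(2) r1[of l] by (auto simp: k_def)
    have "strict_mono k"
      using m(1) r(1) r1 unfolding k_def strict_mono_def strict_mono_on_def by simp
    have xk: "(\<lambda>l. x (k l)) \<longlonglongrightarrow> xs"
      unfolding k_def using LIMSEQ_Suc[OF r(2)] .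
    have "(\<lambda>l. ?m (m (r l))) \<longlonglongrightarrow> 0"
      using LIMSEQ_subseq_LIMSEQ[OF m(3) r(1)] by (simp add: o_def)
    then have "(\<lambda>l. ?m (k l)) \<longlonglongrightarrow> 0" unfolding k_def by (rule LIMSEQ_Suc)
    then have "(\<lambda>l. \<rho> \<gamma>bar (k l)) \<longlonglongrightarrow> 0" by (simp add: measure[OF k1] zero_ereal_def)
    from tendsto_mult_left[OF this, of \<gamma>bar]
    have res: "(\<lambda>l. norm (x (k l) - prox \<gamma>bar \<phi> (x (k l) - \<gamma>bar *\<^sub>R grad (fn (k l)) (x (k l))))) \<longlonglongrightarrow> 0"
      using \<gamma>bar by (simp add: \<rho>_def)
    have "\<forall>l. \<exists>p u. Q (k l) (S (x (k l))) p u" using Q_ex[OF k1] by blast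
    then obtain p u where Q: "\<And>l. Q (k l) (S (x (k l))) (p l) (u l)"
      by metis
    have "(\<lambda>l. \<mu> (k l)) \<longlonglongrightarrow> 0"
      using LIMSEQ_subseq_LIMSEQ[OF mu_lim \<open>strict_mono k\<close>] by (simp add: o_def)
    from tendsto_mult_left[OF this, of "2 * K"] have lim: "(\<lambda>l. 2 * K * \<mu> (k l)) \<longlonglongrightarrow> 0" by simp
    have "eventually (\<lambda>l. norm (S (x (k l)) - p l) \<le> 2 * K * \<mu> (k l)) sequentially"
      using Q by (simp add: Q_def)
    then have "(\<lambda>l. S (x (k l)) - p l) \<longlonglongrightarrow> 0" using lim by (rule Lim_null_comparison)
    moreover have "bounded (range u)" using Q by (auto simp: Q_def intro!: boundedI)
    moreover have "continuous_on UNIV g" by (rule lipschitz_on_continuous_on[OF g_lip])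
    ultimately show ?thesis
      unfolding f_def
      by (intro prox_gradient_limit_stationary[OF phi_proper phi_lsc phi_convex h_grad h_lip S' _ \<gamma>bar
            x_dom[OF k1] xk _ _ _ fn_grad_inner[OF k1 Q] res]) (use Q in \<open>auto simp: Q_def\<close>)
  qed
  ultimately show ?thesis by blast
qed

end
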